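(* There exists an almost disjoint family $\mathcal{A}$ of countable sets which is not locally small (that is, none of the following holds: $\mathcal{A}$ is locally small; $K_{\mathcal{A}}$ is monolithic; $C(K_{\mathcal{A}})$ has the controlled separable complementation property; $C(K_{\mathcal{A}})$ is Lindelöf in the weak topology; the dual unit ball $B_{C(K_{\mathcal{A}})^*}$ is monolithic in the weak$^*$ topology), and yet $C(K_{\mathcal{A}})$ has the separable complementation property.
   Context: A family $\mathcal{A}$ of infinite sets is almost disjoint if $A\cap B$ is finite for all distinct $A,B\in\mathcal{A}$; "countable sets" means that all its members are countably infinite. Put $X=\bigcup\mathcal{A}$. The compact Hausdorff space $K_{\mathcal{A}}$ has underlying set $X\cup\{l_A: A\in\mathcal{A}\}\cup\{\infty\}$ (the points $l_A$ and $\infty$ being new and distinct); each point of $X$ is isolated, basic neighborhoods of $l_A$ are $\{l_A\}\cup(A\setminus F)$ with $F$ finite, and basic neighborhoods of $\infty$ are $K_{\mathcal{A}}\setminus\bigcup_{i<n}(\{l_{A_i}\}\cup A_i)$ with $A_0,\dots,A_{n-1}\in\mathcal{A}$. $C(K)$ is the Banach space of real-valued continuous functions on $K$ with the supremum norm. $\mathcal{A}$ is locally small if for every countable $B\subseteq\bigcup\mathcal{A}$ the set $\{A\in\mathcal{A}: A\cap B\text{ is infinite}\}$ is at most countable. A compact space is monolithic if each of its separable subsets is second countable. A projection on a Banach space $E$ is a bounded linear operator $P:E\to E$ with $P^2=P$; a subspace is complemented if it is the image of a projection. $E$ has the separable complementation property (SCP) if every separable subspace of $E$ is contained in a separable complemented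 subspace. $E$ has the controlled separable complementation property if for every separable subspace $F\subseteq E$ and every (norm-)separable subspace $G\subseteq E^*$ there is a projection $P:E\to E$ with $F\subseteq\operatorname{im}P$, $G\subseteq\operatorname{im}P^*$ and $\operatorname{im}P$ separable. *)

theory Defs
  imports "HOL-Analysis.Analysis" "HOL-Probability.Discrete_Topology"
begin

section \<open>Almost disjoint families and the spaces \<open>K\<^sub>A\<close>\<close>

definition almost_disjoint_family :: "'a set set \<Rightarrow> bool" where
  "almost_disjoint_family \<A> \<longleftrightarrow>
     (\<forall>A\<in>\<A>. infinite A) \<and> (\<forall>A\<in>\<A>. \<forall>B\<in>\<A>. A \<noteq> B \<longrightarrow> finite (A \<inter> B))"

definition locally_small :: "'a set set \<Rightarrow> bool" where
  "locally_small \<A> \<longleftrightarrow>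
     (\<forall>B. B \<subseteq> \<Union>\<A> \<and> countable B \<longrightarrow> countable {A \<in> \<A>. infinite (A \<inter> B)})"

datatype 'a kpoint = Pt 'a | LimPt "'a set" | Infty

definition K_points :: "'a set set \<Rightarrow> 'a kpoint set" where
  "K_points \<A> = Pt ` (\<Union>\<A>) \<union> LimPt ` \<A> \<union> {Infty}"

definition K_open :: "'a set set \<Rightarrow> 'a kpoint set \<Rightarrow> bool" where
  "K_open \<A> U \<longleftrightarrow> U \<subseteq> K_points \<A> \<and>
     (\<forall>A\<in>\<A>. LimPt A \<in> U \<longrightarrow> (\<exists>F. finite F \<and> insert (LimPt A) (Pt ` (A - F)) \<subseteq> U)) \<and>
     (Infty \<in> U \<longrightarrow> (\<exists>\<F>. finite \<F> \<and> \<F> \<subseteq> \<A> \<and>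
        K_points \<A> - (\<Union>A\<in>\<F>. insert (LimPt A) (Pt ` A)) \<subseteq> U))"

definition K_space :: "'a set set \<Rightarrow> 'a kpoint topology" where
  "K_space \<A> = topology (K_open \<A>)"

lemma K_open_LimPtE:
  assumes "K_open \<A> U" "A \<in> \<A>" "LimPt A \<in> U"
  obtains F where "finite F" "insert (LimPt A) (Pt ` (A - F)) \<subseteq> U"
  using assms unfolding K_open_def by blast

lemma K_open_InftyE:
  assumes "K_open \<A> U" "Infty \<in> U"
  obtains \<F> where "finite \<F>" "\<F> \<subseteq> \<A>"
    "K_points \<A> - (\<Union>A\<in>\<F>. insert (LimPt A) (Pt ` A)) \<subseteq> U"
proof -
  have "\<exists>\<F>. finite \<F> \<and> \<F> \<subseteq> \<A> \<and>
      K_points \<A> - (\<Union>A\<in>\<F>. insert (LimPt A) (Pt ` A)) \<subseteq> U"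
    using assms unfolding K_open_def by (elim conjE) (erule (1) mp)
  then show ?thesis using that by (elim exE conjE)
qed

lemma istopology_K_open: "istopology (K_open \<A>)"
  unfolding istopology_def
proof (intro conjI allI impI)
  fix S T assume S: "K_open \<A> S" and T: "K_open \<A> T"
  show "K_open \<A> (S \<inter> T)"
    unfolding K_open_def
  proof (intro conjI ballI impI)
    show "S \<inter> T \<subseteq> K_points \<A>" using S by (auto simp: K_open_def)
  next
    fix A assume A: "A \<in> \<A>" "LimPt A \<in> S \<inter> T"
    obtain F where F: "finite F" "insert (LimPt A) (Pt ` (A - F)) \<subseteq> S"
      by (rule K_open_LimPtE[OF S A(1) IntD1[OF A(2)]])
    obtain G where G: "finite G" "insert (LimPt A) (Pt ` (A - G)) \<subseteq> T"
      by (rule K_open_LimPtE[OF T A(1) IntD2[OF A(2)]])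
    have "insert (LimPt A) (Pt ` (A - (F \<union> G))) \<subseteq> S \<inter> T"
      using F(2) G(2) by blast
    then show "\<exists>F. finite F \<and> insert (LimPt A) (Pt ` (A - F)) \<subseteq> S \<inter> T"
      using F(1) G(1) finite_UnI by blast
  next
    assume I: "Infty \<in> S \<inter> T"
    let ?N = "\<lambda>\<F>. K_points \<A> - (\<Union>A\<in>\<F>. insert (LimPt A) (Pt ` A))"
    obtain \<F> where F: "finite \<F>" "\<F> \<subseteq> \<A>" "?N \<F> \<subseteq> S"
      by (rule K_open_InftyE[OF S IntD1[OF I]])
    obtain \<G> where G: "finite \<G>" "\<G> \<subseteq> \<A>" "?N \<G> \<subseteq> T"
      by (rule K_open_InftyE[OF T IntD2[OF I]])
    have "?N (\<F> \<union> \<G>) = ?N \<F> \<inter> ?N \<G>"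
      by (simp only: UN_Un Diff_Un)
    then have "?N (\<F> \<union> \<G>) \<subseteq> S \<inter> T"
      using Int_mono[OF F(3) G(3)] by (simp only:)
    then show "\<exists>\<F>. finite \<F> \<and> \<F> \<subseteq> \<A> \<and> ?N \<F> \<subseteq> S \<inter> T"
      using F(1,2) G(1,2) by (intro exI[of _ "\<F> \<union> \<G>"] conjI) simp_all
  qed
next
  fix \<K> assume K: "\<forall>K\<in>\<K>. K_open \<A> K"
  show "K_open \<A> (\<Union>\<K>)"
    unfolding K_open_def
  proof (intro conjI ballI impI)
    show "\<Union>\<K> \<subseteq> K_points \<A>" using K by (auto simp: K_open_def)
  next
    fix A assume A: "A \<in> \<A>" "LimPt A \<in> \<Union>\<K>"
    then obtain U where U: "U \<in> \<K>" "LimPt A \<in> U" by blast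
    obtain F where F: "finite F" "insert (LimPt A) (Pt ` (A - F)) \<subseteq> U"
      by (rule K_open_LimPtE[OF bspec[OF K U(1)] A(1) U(2)])
    then have "insert (LimPt A) (Pt ` (A - F)) \<subseteq> \<Union>\<K>"
      using U(1) by blast
    then show "\<exists>F. finite F \<and> insert (LimPt A) (Pt ` (A - F)) \<subseteq> \<Union>\<K>"
      using F(1) by blast
  next
    let ?N = "\<lambda>\<F>. K_points \<A> - (\<Union>A\<in>\<F>. insert (LimPt A) (Pt ` A))"
    assume "Infty \<in> \<Union>\<K>"
    then obtain U where U: "U \<in> \<K>" "Infty \<in> U" by blast
    obtain \<F> where F: "finite \<F>" "\<F> \<subseteq> \<A>" "?N \<F> \<subseteq> U"
      by (rule K_open_InftyE[OF bspec[OF K U(1)] U(2)])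
    show "\<exists>\<F>. finite \<F> \<and> \<F> \<subseteq> \<A> \<and> ?N \<F> \<subseteq> \<Union>\<K>"
      using F(1,2) order_trans[OF F(3) Union_upper[OF U(1)]]
      by (intro exI[of _ "\<F>"] conjI)
  qed
qed

lemma openin_K_space: "openin (K_space \<A>) = K_open \<A>"
  by (simp add: K_space_def istopology_K_open)

lemma topspace_K_space [simp]: "topspace (K_space \<A>) = K_points \<A>"
proof -
  have "K_open \<A> (K_points \<A>)"
    unfolding K_open_def
  proof (intro conjI ballI impI)
    fix A assume "A \<in> \<A>"
    then show "\<exists>F. finite F \<and> insert (LimPt A) (Pt ` (A - F)) \<subseteq> K_points \<A>"
      by (intro exI[of _ "{}"]) (auto simp: K_points_def)
  next
    show "\<exists>\<F>. finite \<F> \<and> \<F> \<subseteq> \<A> \<and>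
        K_points \<A> - (\<Union>A\<in>\<F>. insert (LimPt A) (Pt ` A)) \<subseteq> K_points \<A>"
      by (intro exI[of _ "{}"]) auto
  qed simp
  then show ?thesis
    by (auto simp: topspace_def openin_K_space) (auto simp: K_open_def)
qed

text \<open>Compactness of the space is not part of the following predicate; below it is applied only
  to compact spaces.\<close>

definition monolithic :: "'a topology \<Rightarrow> bool" where
  "monolithic T \<longleftrightarrow>
     (\<forall>S. S \<subseteq> topspace T \<and> separable_space (subtopology T S) \<longrightarrow>
          second_countable (subtopology T S))"


section \<open>The Banach space of continuous functions\<close>

text \<open>A type cannot depend on a topology given as a term, so \<open>C(K)\<close> is a subspace of the Banach
  space of all bounded functions on the underlying type (i.e. bounded continuous functions on
  its discrete copy): each function on \<open>K\<close> is extended by \<open>0\<close> to the points of the type outside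
  \<open>K\<close>. For compact \<open>K\<close> boundedness is automatic and the norm is the supremum norm over \<open>K\<close>;
  see the two lemmas below.\<close>

definition C_space :: "'k topology \<Rightarrow> ('k discrete \<Rightarrow>\<^sub>C real) set" where
  "C_space K = {f. continuous_map K euclideanreal (\<lambda>x. apply_bcontfun f (discrete x)) \<and>
                   (\<forall>x. x \<notin> topspace K \<longrightarrow> apply_bcontfun f (discrete x) = 0)}"

lemma subspace_C_space: "subspace (C_space K)"
  by (auto simp: subspace_def C_space_def plus_bcontfun.rep_eq scaleR_bcontfun.rep_eq
      zero_bcontfun.rep_eq intro!: continuous_map_add continuous_map_real_mult_left)

lemma C_space_represents:
  assumes "compact_space K" "continuous_map K euclideanreal g"
  shows "\<exists>!f. f \<in> C_space K \<and> (\<forall>x\<in>topspace K. apply_bcontfun f (discrete x) = g x)"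
proof -
  define h where "h = (\<lambda>d. if of_discrete d \<in> topspace K then g (of_discrete d) else 0)"
  have "compact (g ` topspace K)"
    using assms image_compactin[of K "topspace K" euclideanreal g]
    by (simp add: compact_space_def)
  then have "bounded (insert 0 (g ` topspace K))"
    by (simp add: compact_imp_bounded)
  then have bd: "bounded (range h)"
    by (rule bounded_subset) (auto simp: h_def)
  have "continuous_on UNIV h"
    unfolding continuous_on_open_invariant by (intro allI impI exI[of _ "h -` _"]) (auto simp: open_discrete)
  with bd have "h \<in> bcontfun" by (simp add: bcontfun_def)
  then obtain f where f: "h = apply_bcontfun f" by (rule bcontfunE)
  have fx: "apply_bcontfun f (discrete x) = (if x \<in> topspace K then g x else 0)" for x
    by (simp flip: f add: h_def discrete_inverse)
  have fC: "f \<in> C_space K"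
    using continuous_map_eq[OF assms(2), of "\<lambda>x. apply_bcontfun f (discrete x)"]
    by (simp add: C_space_def fx)
  show ?thesis
  proof (rule ex1I[of _ f])
    show "f \<in> C_space K \<and> (\<forall>x\<in>topspace K. apply_bcontfun f (discrete x) = g x)"
      using fC by (simp add: fx)
  next
    fix f'
    assume f': "f' \<in> C_space K \<and> (\<forall>x\<in>topspace K. apply_bcontfun f' (discrete x) = g x)"
    show "f' = f"
    proof (rule bcontfun_eqI)
      fix d :: "'a discrete"
      obtain x where d: "d = discrete x" by (cases d) auto
      show "apply_bcontfun f' d = apply_bcontfun f d"
        using f' unfolding d fx C_space_def by (cases "x \<in> topspace K") simp_all
    qed
  qed
qed

lemma norm_C_space:
  assumes f: "f \<in> C_space K" and ne: "topspace K \<noteq> {}"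
  shows "norm f = (SUP x\<in>topspace K. \<bar>apply_bcontfun f (discrete x)\<bar>)"
proof (rule antisym)
  have le: "\<bar>apply_bcontfun f d\<bar> \<le> norm f" for d
    using norm_bounded[of f d] by simp
  then have bdd: "bdd_above ((\<lambda>x. \<bar>apply_bcontfun f (discrete x)\<bar>) ` topspace K)"
    by (intro bdd_aboveI[of _ "norm f"]) auto
  show "norm f \<le> (SUP x\<in>topspace K. \<bar>apply_bcontfun f (discrete x)\<bar>)"
  proof (rule norm_bound)
    fix d :: "'a discrete"
    obtain x where d: "d = discrete x" by (cases d) auto
    obtain y where y: "y \<in> topspace K" using ne by (meson all_not_in_conv)
    show "norm (apply_bcontfun f d) \<le> (SUP x\<in>topspace K. \<bar>apply_bcontfun f (discrete x)\<bar>)"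
    proof (cases "x \<in> topspace K")
      case True
      then show ?thesis using bdd by (auto simp: d intro: cSUP_upper)
    next
      case False
      then have "norm (apply_bcontfun f d) \<le> \<bar>apply_bcontfun f (discrete y)\<bar>"
        using f by (simp add: d C_space_def)
      also have "\<dots> \<le> (SUP x\<in>topspace K. \<bar>apply_bcontfun f (discrete x)\<bar>)"
        using y bdd by (rule cSUP_upper)
      finally show ?thesis .
    qed
  qed
  show "(SUP x\<in>topspace K. \<bar>apply_bcontfun f (discrete x)\<bar>) \<le> norm f"
    using ne le by (intro cSUP_least) auto
qed


section \<open>Operators, duality and complementation for a Banach space \<open>E\<close> given as a carrier set\<close>

text \<open>Throughout, \<open>E\<close> is a linear subspace of a normed space, regarded as a Banach space
  in its own right.\<close>

definition bounded_linear_on ::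
  "'e::real_normed_vector set \<Rightarrow> ('e \<Rightarrow> 'f::real_normed_vector) \<Rightarrow> bool" where
  "bounded_linear_on E f \<longleftrightarrow>
     (\<forall>x\<in>E. \<forall>y\<in>E. f (x + y) = f x + f y) \<and>
     (\<forall>c. \<forall>x\<in>E. f (c *\<^sub>R x) = c *\<^sub>R f x) \<and>
     (\<exists>M. \<forall>x\<in>E. norm (f x) \<le> M * norm x)"

text \<open>Functionals on \<open>E\<close> are made unique as functions on the whole type by the value \<open>0\<close>
  off \<open>E\<close>.\<close>

definition dual_space :: "'e::real_normed_vector set \<Rightarrow> ('e \<Rightarrow> real) set" where
  "dual_space E = {\<phi>. bounded_linear_on E \<phi> \<and> (\<forall>x. x \<notin> E \<longrightarrow> \<phi> x = 0)}"

definition dual_norm :: "'e::real_normed_vector set \<Rightarrow> ('e \<Rightarrow> real) \<Rightarrow> real" where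
  "dual_norm E \<phi> = (SUP x\<in>{x \<in> E. norm x \<le> 1}. \<bar>\<phi> x\<bar>)"

definition dual_subspace :: "'e::real_normed_vector set \<Rightarrow> ('e \<Rightarrow> real) set \<Rightarrow> bool" where
  "dual_subspace E G \<longleftrightarrow> G \<subseteq> dual_space E \<and> (\<lambda>x. 0) \<in> G \<and>
     (\<forall>\<phi>\<in>G. \<forall>\<psi>\<in>G. (\<lambda>x. \<phi> x + \<psi> x) \<in> G) \<and> (\<forall>c. \<forall>\<phi>\<in>G. (\<lambda>x. c * \<phi> x) \<in> G)"

definition dual_norm_separable :: "'e::real_normed_vector set \<Rightarrow> ('e \<Rightarrow> real) set \<Rightarrow> bool" where
  "dual_norm_separable E G \<longleftrightarrow>
     (\<exists>D. countable D \<and> D \<subseteq> G \<and>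
        (\<forall>\<phi>\<in>G. \<forall>\<epsilon>>0. \<exists>\<psi>\<in>D. dual_norm E (\<lambda>x. \<phi> x - \<psi> x) < \<epsilon>))"

definition weak_topology :: "'e::real_normed_vector set \<Rightarrow> 'e topology" where
  "weak_topology E =
     topology_generated_by {{x \<in> E. \<phi> x \<in> U} | \<phi> U. \<phi> \<in> dual_space E \<and> open U}"

definition weak_star_topology :: "'e::real_normed_vector set \<Rightarrow> ('e \<Rightarrow> real) topology" where
  "weak_star_topology E =
     topology_generated_by {{\<phi> \<in> dual_space E. \<phi> x \<in> U} | x U. x \<in> E \<and> open U}"

definition dual_unit_ball :: "'e::real_normed_vector set \<Rightarrow> ('e \<Rightarrow> real) set" where
  "dual_unit_ball E = {\<phi> \<in> dual_space E. dual_norm E \<phi> \<le> 1}"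

definition projection_on :: "'e::real_normed_vector set \<Rightarrow> ('e \<Rightarrow> 'e) \<Rightarrow> bool" where
  "projection_on E P \<longleftrightarrow> bounded_linear_on E P \<and> P ` E \<subseteq> E \<and> (\<forall>x\<in>E. P (P x) = P x)"

definition complemented_in :: "'e::real_normed_vector set \<Rightarrow> 'e set \<Rightarrow> bool" where
  "complemented_in E Z \<longleftrightarrow> (\<exists>P. projection_on E P \<and> P ` E = Z)"

definition adjoint_on ::
  "'e::real_normed_vector set \<Rightarrow> ('e \<Rightarrow> 'e) \<Rightarrow> ('e \<Rightarrow> real) \<Rightarrow> ('e \<Rightarrow> real)" where
  "adjoint_on E P \<phi> = (\<lambda>x. if x \<in> E then \<phi> (P x) else 0)"

text \<open>Subspaces are not required to be closed in the next two definitions. This makes no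
  difference: closures of separable subspaces are separable, and the images of projections and
  of their adjoints are closed.\<close>

definition SCP :: "'e::real_normed_vector set \<Rightarrow> bool" where
  "SCP E \<longleftrightarrow>
     (\<forall>F. subspace F \<and> F \<subseteq> E \<and> separable_space (top_of_set F) \<longrightarrow>
        (\<exists>Z. F \<subseteq> Z \<and> separable_space (top_of_set Z) \<and> complemented_in E Z))"

definition controlled_SCP :: "'e::real_normed_vector set \<Rightarrow> bool" where
  "controlled_SCP E \<longleftrightarrow>
     (\<forall>F G. subspace F \<and> F \<subseteq> E \<and> separable_space (top_of_set F) \<and>
            dual_subspace E G \<and> dual_norm_separable E G \<longrightarrow>
        (\<exists>P. projection_on E P \<and> F \<subseteq> P ` E \<and> G \<subseteq> adjoint_on E P ` dual_space E \<and>
             separable_space (top_of_set (P ` E))))"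

end

theory Submission
  imports Defs
begin

text \<open>The failures and the complementation property pull in opposite directions. If uncountably many
members of \<open>\<A>\<close> meet a countable set \<open>B\<close> in an infinite set, then a projection \<open>P\<close> of \<open>C(K)\<close> with
separable image cannot satisfy \<open>P f = f\<close> on \<open>B\<close> for all \<open>f\<close>, because the characteristic functions
of these members are at distance \<open>1\<close> from each other on \<open>B\<close>. So a projection has to change the
values on \<open>B\<close>, while it fixes the functions in its image.

The way out is to give every countable piece of the space a mirror image elsewhere. Suppose that
countable \<open>\<S> \<subseteq> \<A>\<close> and countable \<open>X \<supseteq> \<Union>\<S>\<close> admit an injection \<open>\<phi>\<close> of \<open>X\<close> into its complement such
that every \<open>A \<in> \<A> - \<S>\<close> contains \<open>p\<close> if and only if it contains \<open>\<phi> p\<close>, for all but finitely many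
\<open>p \<in> X\<close>. Then \<open>P f\<close>, with value \<open>f(p) - f(\<phi> p) + f(\<infinity>)\<close> at \<open>p \<in> X\<close>, value \<open>f(l\<^sub>A)\<close> at \<open>l\<^sub>A\<close> for
\<open>A \<in> \<S>\<close> and value \<open>f(\<infinity>)\<close> everywhere else, is continuous: along \<open>A \<in> \<A> - \<S>\<close> the first two terms
cancel in the limit, and along \<open>A \<in> \<S>\<close> the points \<open>\<phi> p\<close> tend to \<open>\<infinity>\<close>. It projects \<open>C(K)\<close> onto the
functions that are constant off \<open>X \<union> {l\<^sub>A : A \<in> \<S>}\<close>, which form a separable space. A family
in which such \<open>\<S>\<close>, \<open>X\<close>, \<open>\<phi>\<close> exist above any countable subfamily is called mirrored below;
\<open>SCP_if_mirrored\<close> is the result.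

A mirrored family that is not locally small has an explicit description
(\<open>exists_mirrored_family\<close>). Let \<open>W\<close> be an uncountable set of reals in \<open>[0, 1)\<close> with a total order whose
initial segments \<open>D a = {d. d \<le> a}\<close> are countable, and number each \<open>D a\<close> by natural numbers. The
points are triples \<open>(k, m, l)\<close>, where \<open>(k, m)\<close> is a dyadic interval of length \<open>2\<^sup>-\<^sup>k\<close> and \<open>l\<close> a finite
list of distinct elements of \<open>W\<close>; the set belonging to \<open>a\<close> consists of the triples for which \<open>a\<close> lies in the
interval and all entries of \<open>l\<close> are elements of \<open>D a\<close> with number at most \<open>k\<close>. For fixed \<open>k\<close> there are
only finitely many such triples, and this makes the family almost disjoint. The mirror is
\<open>\<phi> (k, m, l) = (k, m, \<delta> # l)\<close> for some \<open>\<delta>\<close> above the countably many indices under consideration: for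
\<open>a \<ge> \<delta>\<close> it respects membership as soon as \<open>k\<close> is at least the number of \<open>\<delta>\<close> in \<open>D a\<close>.

The triples with \<open>l = []\<close> are countably many and all sets of the family meet them in infinite sets,
so local smallness fails. Monolithicity of \<open>K\<close> and of the dual ball then fails because of the points \<open>l\<^sub>A\<close>
and their evaluation functionals. For the weak Lindelof property, the triples \<open>(k, m, [])\<close>
with fixed \<open>k\<close> form finite levels that every member of the family meets. Hence a
weak neighbourhood given by the points of a single level separates all characteristic functions of members
from a function that vanishes at \<open>\<infinity>\<close> and all \<open>l\<^sub>A\<close>, and these characteristic functions form
an uncountable closed discrete set.\<close>

section \<open>Continuous functions on the space of an almost disjoint family\<close>

abbreviation K_val :: "('k discrete \<Rightarrow>\<^sub>C real) \<Rightarrow> 'k \<Rightarrow> real" where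
  "K_val f x \<equiv> apply_bcontfun f (discrete x)"

definition of_bounded :: "('k \<Rightarrow> real) \<Rightarrow> ('k discrete \<Rightarrow>\<^sub>C real)" where
  "of_bounded h = Bcontfun (\<lambda>d. h (of_discrete d))"

lemma K_val_of_bounded:
  assumes "\<And>x. \<bar>h x\<bar> \<le> M"
  shows "K_val (of_bounded h) x = h x"
proof -
  have "continuous_on UNIV (\<lambda>d. h (of_discrete d))"
    unfolding continuous_on_open_invariant
    by (intro allI impI exI[of _ "(\<lambda>d. h (of_discrete d)) -` _"]) (auto simp: open_discrete)
  then have "(\<lambda>d. h (of_discrete d)) \<in> bcontfun"
    using assms by (intro bcontfun_normI[of _ M]) auto
  then show ?thesis
    by (simp add: of_bounded_def Bcontfun_inverse discrete_inverse)
qed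

lemma K_val_eqI: "(\<And>x. K_val f x = K_val g x) \<Longrightarrow> f = g"
  by (rule bcontfun_eqI) (metis of_discrete_inverse)

lemma K_val_arith [simp]:
  "K_val (f + g) x = K_val f x + K_val g x" "K_val (f - g) x = K_val f x - K_val g x"
  "K_val (c *\<^sub>R f) x = c * K_val f x" "K_val 0 x = 0"
  by (simp_all add: plus_bcontfun.rep_eq minus_bcontfun.rep_eq scaleR_bcontfun.rep_eq
      zero_bcontfun.rep_eq)

lemma abs_K_val_le: "\<bar>K_val f x\<bar> \<le> norm f"
  using norm_bounded[of f "discrete x"] by simp

lemma norm_le_K_val: "(\<And>x. \<bar>K_val f x\<bar> \<le> b) \<Longrightarrow> norm f \<le> b"
  by (rule norm_bound) (metis of_discrete_inverse real_norm_def)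

definition K_nbhd :: "'a set \<Rightarrow> 'a kpoint set" where
  "K_nbhd A = insert (LimPt A) (Pt ` A)"

lemma mem_K_nbhd [simp]: "Pt p \<in> K_nbhd A \<longleftrightarrow> p \<in> A" "LimPt B \<in> K_nbhd A \<longleftrightarrow> B = A"
  "Infty \<notin> K_nbhd A"
  by (auto simp: K_nbhd_def)

lemma mem_K_points [simp]: "Pt p \<in> K_points \<A> \<longleftrightarrow> p \<in> \<Union>\<A>" "LimPt A \<in> K_points \<A> \<longleftrightarrow> A \<in> \<A>"
  "Infty \<in> K_points \<A>"
  by (auto simp: K_points_def)

text \<open>The points of \<open>\<Union>\<A>\<close> are isolated, so continuity is a condition at the \<open>l\<^sub>A\<close> and at \<open>\<infinity>\<close>, and the basic
neighbourhoods of these points turn it into a finiteness condition. All later continuity proofs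
go through this criterion.\<close>

lemma continuous_map_K_space_iff:
  "continuous_map (K_space \<A>) euclideanreal h \<longleftrightarrow>
     (\<forall>e>0. (\<forall>A\<in>\<A>. finite {p \<in> A. e \<le> \<bar>h (Pt p) - h (LimPt A)\<bar>}) \<and>
            (\<exists>\<F>. finite \<F> \<and> \<F> \<subseteq> \<A> \<and>
               {x \<in> K_points \<A>. e \<le> \<bar>h x - h Infty\<bar>} \<subseteq> (\<Union>A\<in>\<F>. K_nbhd A)))"
    (is "?cont \<longleftrightarrow> (\<forall>e>0. ?lim e \<and> ?inf e)")
proof (intro iffI allI impI)
  fix e :: real assume h: ?cont and e: "e > 0"
  have op: "K_open \<A> {x \<in> K_points \<A>. h x \<in> ball c e}" for c
    using h e openin_continuous_map_preimage[of "K_space \<A>" euclideanreal h "ball c e"]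
    by (simp add: openin_K_space)
  show "?lim e \<and> ?inf e"
  proof (intro conjI ballI)
    fix A assume A: "A \<in> \<A>"
    then obtain F where "finite F"
      "insert (LimPt A) (Pt ` (A - F)) \<subseteq> {x \<in> K_points \<A>. h x \<in> ball (h (LimPt A)) e}"
      using K_open_LimPtE[OF op A, of "h (LimPt A)"] e by auto
    then have "{p \<in> A. e \<le> \<bar>h (Pt p) - h (LimPt A)\<bar>} \<subseteq> F"
      by (force simp: dist_real_def)
    then show "finite {p \<in> A. e \<le> \<bar>h (Pt p) - h (LimPt A)\<bar>}"
      using \<open>finite F\<close> finite_subset by blast
  next
    obtain \<F> where "finite \<F>" "\<F> \<subseteq> \<A>"
      "K_points \<A> - (\<Union>A\<in>\<F>. insert (LimPt A) (Pt ` A)) \<subseteq> {x \<in> K_points \<A>. h x \<in> ball (h Infty) e}"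
      using K_open_InftyE[OF op, of "h Infty"] e by auto
    then show "?inf e"
      by (intro exI[of _ \<F>]) (force simp: dist_real_def K_nbhd_def)
  qed
next
  assume h: "\<forall>e>0. ?lim e \<and> ?inf e"
  have "K_open \<A> {x \<in> K_points \<A>. h x \<in> U}" if U: "open U" for U
    unfolding K_open_def
  proof (intro conjI ballI impI)
    fix A assume A: "A \<in> \<A>" "LimPt A \<in> {x \<in> K_points \<A>. h x \<in> U}"
    then obtain e where e: "e > 0" "ball (h (LimPt A)) e \<subseteq> U"
      using U open_contains_ball by blast
    have "t \<in> U" if "\<not> e \<le> \<bar>t - h (LimPt A)\<bar>" for t
      using that e(2) by (auto simp: dist_real_def abs_minus_commute)
    then have "insert (LimPt A) (Pt ` (A - {p \<in> A. e \<le> \<bar>h (Pt p) - h (LimPt A)\<bar>}))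
        \<subseteq> {x \<in> K_points \<A>. h x \<in> U}"
      using A by auto
    moreover have "finite {p \<in> A. e \<le> \<bar>h (Pt p) - h (LimPt A)\<bar>}"
      using h[rule_format, OF e(1)] A(1) by simp
    ultimately show "\<exists>F. finite F \<and> insert (LimPt A) (Pt ` (A - F)) \<subseteq> {x \<in> K_points \<A>. h x \<in> U}"
      by (intro exI conjI)
  next
    assume I: "Infty \<in> {x \<in> K_points \<A>. h x \<in> U}"
    then obtain e where e: "e > 0" "ball (h Infty) e \<subseteq> U"
      using U open_contains_ball by blast
    obtain \<F> where F: "finite \<F>" "\<F> \<subseteq> \<A>"
      "{x \<in> K_points \<A>. e \<le> \<bar>h x - h Infty\<bar>} \<subseteq> (\<Union>A\<in>\<F>. K_nbhd A)"
      using h[rule_format, OF e(1)] by auto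
    have "K_points \<A> - (\<Union>A\<in>\<F>. K_nbhd A) \<subseteq> {x \<in> K_points \<A>. h x \<in> U}"
    proof
      fix x assume x: "x \<in> K_points \<A> - (\<Union>A\<in>\<F>. K_nbhd A)"
      then have "\<bar>h x - h Infty\<bar> < e"
        using F(3) by force
      then have "h x \<in> ball (h Infty) e"
        by (simp add: dist_real_def abs_minus_commute)
      then show "x \<in> {x \<in> K_points \<A>. h x \<in> U}"
        using x e(2) by blast
    qed
    then show "\<exists>\<F>. finite \<F> \<and> \<F> \<subseteq> \<A> \<and>
        K_points \<A> - (\<Union>A\<in>\<F>. insert (LimPt A) (Pt ` A)) \<subseteq> {x \<in> K_points \<A>. h x \<in> U}"
      using F(1,2) unfolding K_nbhd_def by blast
  qed auto
  then show ?cont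
    by (auto simp: continuous_map openin_K_space)
qed

abbreviation CK :: "'a set set \<Rightarrow> ('a kpoint discrete \<Rightarrow>\<^sub>C real) set" where
  "CK \<A> \<equiv> C_space (K_space \<A>)"

lemma CK_cofinite_at_LimPt:
  assumes "f \<in> CK \<A>" "A \<in> \<A>" "e > 0"
  shows "finite {p \<in> A. e \<le> \<bar>K_val f (Pt p) - K_val f (LimPt A)\<bar>}"
  using assms by (auto simp: C_space_def continuous_map_K_space_iff)

lemma CK_near_Infty:
  assumes "f \<in> CK \<A>" "e > 0"
  obtains \<F> where "finite \<F>" "\<F> \<subseteq> \<A>"
    "{x \<in> K_points \<A>. e \<le> \<bar>K_val f x - K_val f Infty\<bar>} \<subseteq> (\<Union>A\<in>\<F>. K_nbhd A)"
  using assms by (auto simp: C_space_def continuous_map_K_space_iff)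

lemma CK_outside: "f \<in> CK \<A> \<Longrightarrow> x \<notin> K_points \<A> \<Longrightarrow> K_val f x = 0"
  by (auto simp: C_space_def)

lemma of_bounded_in_CK:
  assumes "\<And>x. \<bar>h x\<bar> \<le> M" "\<And>x. x \<notin> K_points \<A> \<Longrightarrow> h x = 0"
    and "\<And>e A. e > 0 \<Longrightarrow> A \<in> \<A> \<Longrightarrow> finite {p \<in> A. e \<le> \<bar>h (Pt p) - h (LimPt A)\<bar>}"
    and "\<And>e. e > 0 \<Longrightarrow> \<exists>\<F>. finite \<F> \<and> \<F> \<subseteq> \<A> \<and>
               {x \<in> K_points \<A>. e \<le> \<bar>h x - h Infty\<bar>} \<subseteq> (\<Union>A\<in>\<F>. K_nbhd A)"
  shows "of_bounded h \<in> CK \<A>"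
  using assms by (auto simp: C_space_def continuous_map_K_space_iff K_val_of_bounded[OF assms(1)])

definition CK_indicator :: "'a set \<Rightarrow> ('a kpoint discrete \<Rightarrow>\<^sub>C real)" where
  "CK_indicator A = of_bounded (indicator (K_nbhd A))"

lemma K_val_CK_indicator: "K_val (CK_indicator A) x = indicator (K_nbhd A) x"
  unfolding CK_indicator_def by (rule K_val_of_bounded[where M = 1]) (simp add: indicator_def)

lemma CK_indicator_in_CK:
  assumes "almost_disjoint_family \<A>" "A \<in> \<A>"
  shows "CK_indicator A \<in> CK \<A>"
  unfolding CK_indicator_def
proof (rule of_bounded_in_CK[where M = 1])
  fix e :: real and B assume "e > 0" "B \<in> \<A>"
  then have "finite (A \<inter> B)" if "A \<noteq> B"
    using assms that by (auto simp: almost_disjoint_family_def)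
  then show "finite {p \<in> B. e \<le> \<bar>indicator (K_nbhd A) (Pt p) - indicator (K_nbhd A) (LimPt B) :: real\<bar>}"
    using \<open>e > 0\<close> by (cases "A = B") (auto simp: indicator_def elim!: rev_finite_subset)
next
  fix e :: real assume "e > 0"
  then show "\<exists>\<F>. finite \<F> \<and> \<F> \<subseteq> \<A> \<and> {x \<in> K_points \<A>.
      e \<le> \<bar>indicator (K_nbhd A) x - indicator (K_nbhd A) Infty :: real\<bar>} \<subseteq> (\<Union>A\<in>\<F>. K_nbhd A)"
    using assms(2) by (intro exI[of _ "{A}"]) (auto simp: indicator_def split: if_splits)
qed (use assms(2) in \<open>auto simp: indicator_def K_nbhd_def\<close>)

definition point_eval :: "'a set set \<Rightarrow> 'a kpoint \<Rightarrow> ('a kpoint discrete \<Rightarrow>\<^sub>C real) \<Rightarrow> real" where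
  "point_eval \<A> x f = (if f \<in> CK \<A> then K_val f x else 0)"

lemma CK_closed:
  "f \<in> CK \<A> \<Longrightarrow> g \<in> CK \<A> \<Longrightarrow> f + g \<in> CK \<A>" "f \<in> CK \<A> \<Longrightarrow> g \<in> CK \<A> \<Longrightarrow> f - g \<in> CK \<A>"
  "f \<in> CK \<A> \<Longrightarrow> c *\<^sub>R f \<in> CK \<A>" "0 \<in> CK \<A>"
  using subspace_C_space[of "K_space \<A>"]
  by (auto simp: subspace_add subspace_diff subspace_scale subspace_0)

lemma point_eval_in_dual_ball: "point_eval \<A> x \<in> dual_unit_ball (CK \<A>)"
proof -
  have "bounded_linear_on (CK \<A>) (point_eval \<A> x)"
    unfolding bounded_linear_on_def point_eval_def
    using abs_K_val_le by (auto simp: CK_closed intro!: exI[of _ 1])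
  then have "point_eval \<A> x \<in> dual_space (CK \<A>)"
    by (auto simp: dual_space_def point_eval_def)
  moreover have "dual_norm (CK \<A>) (point_eval \<A> x) \<le> 1"
    unfolding dual_norm_def
  proof (rule cSUP_least)
    show "{f \<in> CK \<A>. norm f \<le> 1} \<noteq> {}"
      using CK_closed(4) by (metis (mono_tags, lifting) empty_iff mem_Collect_eq norm_zero zero_le_one)
    show "\<bar>point_eval \<A> x f\<bar> \<le> 1" if "f \<in> {f \<in> CK \<A>. norm f \<le> 1}" for f
      using that abs_K_val_le[of f x] by (simp add: point_eval_def)
  qed
  ultimately show ?thesis
    by (simp add: dual_unit_ball_def)
qed

lemma point_eval_in_dual: "point_eval \<A> x \<in> dual_space (CK \<A>)"
  using point_eval_in_dual_ball by (auto simp: dual_unit_ball_def)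

section \<open>Failure of monolithicity\<close>

text \<open>Members of a base that fit between \<open>x i\<close> and \<open>U i\<close> are pairwise different.\<close>

lemma not_second_countable_if_uncountable_isolated:
  assumes "uncountable I" and "\<And>i. i \<in> I \<Longrightarrow> openin X (U i) \<and> x i \<in> U i"
    and "\<And>i j. i \<in> I \<Longrightarrow> j \<in> I \<Longrightarrow> i \<noteq> j \<Longrightarrow> x j \<notin> U i"
  shows "\<not> second_countable X"
proof
  assume "second_countable X"
  then obtain \<B> where \<B>: "countable \<B>" "\<And>U x. openin X U \<Longrightarrow> x \<in> U \<Longrightarrow> \<exists>V\<in>\<B>. x \<in> V \<and> V \<subseteq> U"
    unfolding second_countable_def by auto
  have "\<forall>i\<in>I. \<exists>V. V \<in> \<B> \<and> x i \<in> V \<and> V \<subseteq> U i"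
    using \<B>(2) assms(2) by blast
  then obtain V where V: "\<And>i. i \<in> I \<Longrightarrow> V i \<in> \<B> \<and> x i \<in> V i \<and> V i \<subseteq> U i"
    by metis
  have "inj_on V I"
  proof (rule inj_onI, rule ccontr)
    fix i j assume "i \<in> I" "j \<in> I" "V i = V j" "i \<noteq> j"
    then show False
      using V[of i] V[of j] assms(3)[of i j] by auto
  qed
  moreover have "countable (V ` I)"
    using V by (intro countable_subset[OF _ \<B>(1)]) auto
  ultimately show False
    using assms(1) countable_image_inj_on by blast
qed

lemma separable_top_of_set_iff:
  "separable_space (top_of_set S) \<longleftrightarrow>
     (\<exists>C. countable C \<and> C \<subseteq> S \<and> (\<forall>x\<in>S. \<forall>e>0. \<exists>c\<in>C. dist c x < e))"
proof -
  have "top_of_set S closure_of C = S \<longleftrightarrow> S \<subseteq> closure C" if "C \<subseteq> S" for C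
    using that by (auto simp: closure_of_subtopology Int_absorb1)
  then have "top_of_set S closure_of C = S \<longleftrightarrow> (\<forall>x\<in>S. \<forall>e>0. \<exists>c\<in>C. dist c x < e)" if "C \<subseteq> S" for C
    using that by (auto simp: subset_iff closure_approachable)
  then show ?thesis
    by (auto simp: separable_space_def)
qed

lemma separable_isolated_subset_countable:
  assumes "separable_space (top_of_set S)" "\<And>i. i \<in> I \<Longrightarrow> g i \<in> S" "d > 0"
    and "\<And>i j. i \<in> I \<Longrightarrow> j \<in> I \<Longrightarrow> i \<noteq> j \<Longrightarrow> d \<le> dist (g i) (g j)"
  shows "countable I"
proof -
  obtain C where C: "countable C" "\<And>x e. x \<in> S \<Longrightarrow> e > 0 \<Longrightarrow> \<exists>c\<in>C. dist c x < e"
    using assms(1) unfolding separable_top_of_set_iff by blast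
  have "\<forall>i\<in>I. \<exists>c. c \<in> C \<and> dist c (g i) < d / 2"
    using C(2) assms(2,3) by (meson half_gt_zero)
  then obtain c where c: "\<And>i. i \<in> I \<Longrightarrow> c i \<in> C \<and> dist (c i) (g i) < d / 2"
    by metis
  have "inj_on c I"
  proof (rule inj_onI, rule ccontr)
    fix i j assume ij: "i \<in> I" "j \<in> I" "c i = c j" "i \<noteq> j"
    have "dist (g i) (g j) < d / 2 + d / 2"
      using dist_triangle3[of "g i" "g j" "c i"] c[OF ij(1)] c[OF ij(2)] ij(3) by simp
    then show False
      using assms(4)[OF ij(1,2,4)] by simp
  qed
  moreover have "countable (c ` I)"
    using c by (intro countable_subset[OF _ C(1)]) auto
  ultimately show ?thesis
    using countable_image_inj_on by blast
qed

text \<open>Every neighbourhood of \<open>l\<^sub>A\<close> contains almost all points of \<open>A\<close>, hence some point of \<open>B\<close>; so \<open>B\<close> is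
dense here.\<close>

lemma separable_K_subspace:
  assumes "countable B" "\<A>' \<subseteq> \<A>" "B \<subseteq> \<Union>\<A>" "\<And>A. A \<in> \<A>' \<Longrightarrow> infinite (A \<inter> B)"
  shows "separable_space (subtopology (K_space \<A>) (Pt ` B \<union> LimPt ` \<A>'))" (is "separable_space ?Y")
  unfolding separable_space_def
proof (intro exI conjI)
  have YK: "Pt ` B \<union> LimPt ` \<A>' \<subseteq> topspace (K_space \<A>)"
    using assms(2,3) by (auto simp: K_points_def)
  then have top: "topspace ?Y = Pt ` B \<union> LimPt ` \<A>'"
    by (rule topspace_subtopology_subset)
  show "countable (Pt ` B)" "Pt ` B \<subseteq> topspace ?Y"
    using assms(1) unfolding top by auto
  have "x \<in> ?Y closure_of (Pt ` B)" if x: "x \<in> topspace ?Y" for x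
    unfolding in_closure_of
  proof (intro conjI allI impI x, elim conjE)
    fix T assume T: "x \<in> T" "openin ?Y T"
    show "\<exists>y. y \<in> Pt ` B \<and> y \<in> T"
    proof (cases "x \<in> Pt ` B")
      case False
      then obtain A where A: "A \<in> \<A>'" "x = LimPt A"
        using x unfolding top by blast
      obtain V where V: "K_open \<A> V" "T = V \<inter> (Pt ` B \<union> LimPt ` \<A>')"
        using T(2) by (auto simp: openin_subtopology openin_K_space)
      obtain F where F: "finite F" "insert (LimPt A) (Pt ` (A - F)) \<subseteq> V"
        using K_open_LimPtE[OF V(1), of A] A T(1) V(2) assms(2) by blast
      obtain p where "p \<in> A \<inter> B - F"
        using assms(4)[OF A(1)] F(1) by (metis Diff_infinite_finite ex_in_conv finite.emptyI)
      then show ?thesis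
        using F(2) V(2) by (intro exI[of _ "Pt p"]) auto
    qed (use T in auto)
  qed
  then show "?Y closure_of (Pt ` B) = topspace ?Y"
    by (intro equalityI closure_of_subset_topspace subsetI)
qed

lemma not_locally_smallE:
  assumes "\<not> locally_small \<A>"
  obtains B where "countable B" "B \<subseteq> \<Union>\<A>" "uncountable {A \<in> \<A>. infinite (A \<inter> B)}"
  using assms by (auto simp: locally_small_def)

lemma not_monolithic_K_space:
  assumes "\<not> locally_small \<A>"
  shows "\<not> monolithic (K_space \<A>)"
proof -
  obtain B where B: "countable B" "B \<subseteq> \<Union>\<A>" "uncountable {A \<in> \<A>. infinite (A \<inter> B)}"
    using assms by (rule not_locally_smallE)
  define \<A>' where "\<A>' = {A \<in> \<A>. infinite (A \<inter> B)}"
  define Y where "Y = Pt ` B \<union> LimPt ` \<A>'"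
  have "K_open \<A> (K_nbhd A)" if "A \<in> \<A>" for A
    using that by (auto simp: K_open_def K_nbhd_def K_points_def intro: exI[of _ "{}"])
  then have "\<not> second_countable (subtopology (K_space \<A>) Y)"
    using B(3)
    by (intro not_second_countable_if_uncountable_isolated[of \<A>' _ "\<lambda>A. K_nbhd A \<inter> Y" LimPt])
      (auto simp: \<A>'_def Y_def openin_K_space intro!: openin_subtopology_Int)
  moreover have "separable_space (subtopology (K_space \<A>) Y)"
    unfolding Y_def using B by (intro separable_K_subspace) (auto simp: \<A>'_def)
  moreover have "Y \<subseteq> topspace (K_space \<A>)"
    by (auto simp: Y_def \<A>'_def dest!: subsetD[OF B(2)])
  ultimately show ?thesis
    unfolding monolithic_def by blast
qed

lemma openin_weak_star:
  assumes "f \<in> E" "open U"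
  shows "openin (weak_star_topology E) {\<phi> \<in> dual_space E. \<phi> f \<in> U}"
  unfolding weak_star_topology_def using assms by (intro topology_generated_by_Basis) blast

text \<open>Evaluation maps \<open>K\<close> continuously into the dual ball, so it carries the separable subspaces of \<open>K\<close> found above to
separable subspaces of the dual ball.\<close>

lemma continuous_point_eval:
  "continuous_map (K_space \<A>) (weak_star_topology (CK \<A>)) (point_eval \<A>)"
  unfolding weak_star_topology_def
proof (rule continuous_on_generated_topo)
  fix V assume "V \<in> {{\<phi> \<in> dual_space (CK \<A>). \<phi> f \<in> U} | f U. f \<in> CK \<A> \<and> open U}"
  then obtain f U where V: "V = {\<phi> \<in> dual_space (CK \<A>). \<phi> f \<in> U}" "f \<in> CK \<A>" "open U"
    by blast
  have "point_eval \<A> -` V \<inter> topspace (K_space \<A>) = {x \<in> topspace (K_space \<A>). K_val f x \<in> U}"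
    using V point_eval_in_dual by (auto simp: point_eval_def)
  then show "openin (K_space \<A>) (point_eval \<A> -` V \<inter> topspace (K_space \<A>))"
    using V openin_continuous_map_preimage[of "K_space \<A>" euclideanreal "K_val f" U]
    by (simp add: C_space_def)
next
  show "point_eval \<A> ` topspace (K_space \<A>)
      \<subseteq> \<Union>{{\<phi> \<in> dual_space (CK \<A>). \<phi> f \<in> U} | f U. f \<in> CK \<A> \<and> open U}"
  proof -
    have "dual_space (CK \<A>) \<in> {{\<phi> \<in> dual_space (CK \<A>). \<phi> f \<in> U} | f U. f \<in> CK \<A> \<and> open U}"
      using CK_closed(4)[of \<A>] by (auto intro!: exI[of _ 0] exI[of _ UNIV])
    then show ?thesis
      using point_eval_in_dual by blast
  qed
qed

text \<open>The functionals at the points \<open>l\<^sub>A\<close> are isolated from each other because the characteristic function of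
\<open>A\<close> takes the value \<open>1\<close> at \<open>l\<^sub>A\<close> and \<open>0\<close> at all other points of this kind.\<close>

lemma not_monolithic_dual_unit_ball:
  assumes "almost_disjoint_family \<A>" "\<not> locally_small \<A>"
  shows "\<not> monolithic (subtopology (weak_star_topology (CK \<A>)) (dual_unit_ball (CK \<A>)))"
proof -
  obtain B where B: "countable B" "B \<subseteq> \<Union>\<A>" "uncountable {A \<in> \<A>. infinite (A \<inter> B)}"
    using assms(2) by (rule not_locally_smallE)
  define \<A>' where "\<A>' = {A \<in> \<A>. infinite (A \<inter> B)}"
  define Y where "Y = Pt ` B \<union> LimPt ` \<A>'"
  define S where "S = point_eval \<A> ` Y"
  let ?W = "weak_star_topology (CK \<A>)"
  have Y: "Y \<subseteq> K_points \<A>"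
    by (auto simp: Y_def \<A>'_def dest!: subsetD[OF B(2)])
  have W: "dual_space (CK \<A>) \<subseteq> topspace ?W"
    using openin_subset[OF openin_weak_star[OF CK_closed(4) open_UNIV]] by simp
  have S: "S \<subseteq> dual_unit_ball (CK \<A>)" "S \<subseteq> dual_space (CK \<A>)"
    by (auto simp: S_def point_eval_in_dual_ball point_eval_in_dual)
  have sub: "subtopology (subtopology ?W (dual_unit_ball (CK \<A>))) S = subtopology ?W S"
    using S(1) by (simp add: subtopology_subtopology Int_absorb1)
  have "\<not> second_countable (subtopology ?W S)"
  proof (rule not_second_countable_if_uncountable_isolated
      [of \<A>' _ "\<lambda>A. {\<phi> \<in> dual_space (CK \<A>). \<phi> (CK_indicator A) \<in> {1/2<..}} \<inter> S"
          "\<lambda>A. point_eval \<A> (LimPt A)"])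
    have v: "point_eval \<A> (LimPt A') (CK_indicator A) = indicator {A} A'" if "A \<in> \<A>" for A A'
      using CK_indicator_in_CK[OF assms(1) that]
      by (simp add: point_eval_def K_val_CK_indicator indicator_def)
    show "uncountable \<A>'"
      using B(3) by (simp add: \<A>'_def)
    show "openin (subtopology ?W S) ({\<phi> \<in> dual_space (CK \<A>). \<phi> (CK_indicator A) \<in> {1/2<..}} \<inter> S) \<and>
        point_eval \<A> (LimPt A) \<in> {\<phi> \<in> dual_space (CK \<A>). \<phi> (CK_indicator A) \<in> {1/2<..}} \<inter> S"
      if "A \<in> \<A>'" for A
    proof
      show "openin (subtopology ?W S) ({\<phi> \<in> dual_space (CK \<A>). \<phi> (CK_indicator A) \<in> {1/2<..}} \<inter> S)"
        using that assms(1)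
        by (intro openin_subtopology_Int openin_weak_star CK_indicator_in_CK) (auto simp: \<A>'_def)
      show "point_eval \<A> (LimPt A) \<in> {\<phi> \<in> dual_space (CK \<A>). \<phi> (CK_indicator A) \<in> {1/2<..}} \<inter> S"
        using that v[of A A] by (auto simp: \<A>'_def S_def Y_def point_eval_in_dual)
    qed
    show "point_eval \<A> (LimPt A') \<notin> {\<phi> \<in> dual_space (CK \<A>). \<phi> (CK_indicator A) \<in> {1/2<..}} \<inter> S"
      if "A \<in> \<A>'" "A' \<in> \<A>'" "A \<noteq> A'" for A A'
      using that v[of A A'] by (auto simp: \<A>'_def)
  qed
  moreover have "separable_space (subtopology ?W S)"
  proof (rule separable_space_continuous_map_image)
    show "separable_space (subtopology (K_space \<A>) Y)"
      unfolding Y_def using B by (intro separable_K_subspace) (auto simp: \<A>'_def)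
    show "continuous_map (subtopology (K_space \<A>) Y) (subtopology ?W S) (point_eval \<A>)"
      using continuous_point_eval
      by (intro continuous_map_into_subtopology continuous_map_from_subtopology) (auto simp: S_def)
    show "point_eval \<A> ` topspace (subtopology (K_space \<A>) Y) = topspace (subtopology ?W S)"
      using Y W S by (auto simp: S_def topspace_subtopology_subset)
  qed
  moreover have "S \<subseteq> topspace (subtopology ?W (dual_unit_ball (CK \<A>)))"
    using W S by auto
  ultimately show ?thesis
    unfolding monolithic_def sub[symmetric] by blast
qed

section \<open>Failure of the controlled separable complementation property\<close>

lemma dual_space_bounded:
  assumes "\<phi> \<in> dual_space E"
  shows "\<exists>M. \<forall>x\<in>E. \<bar>\<phi> x\<bar> \<le> M * norm x"
  using assms unfolding dual_space_def bounded_linear_on_def real_norm_def by blast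

lemma dual_space_add:
  assumes "subspace E" "\<phi> \<in> dual_space E" "\<psi> \<in> dual_space E"
  shows "(\<lambda>x. \<phi> x + \<psi> x) \<in> dual_space E"
proof -
  obtain M where M: "\<And>x. x \<in> E \<Longrightarrow> \<bar>\<phi> x\<bar> \<le> M * norm x"
    using dual_space_bounded[OF assms(2)] by blast
  obtain N where N: "\<And>x. x \<in> E \<Longrightarrow> \<bar>\<psi> x\<bar> \<le> N * norm x"
    using dual_space_bounded[OF assms(3)] by blast
  have "\<bar>\<phi> x + \<psi> x\<bar> \<le> (M + N) * norm x" if "x \<in> E" for x
    using M[OF that] N[OF that] abs_triangle_ineq[of "\<phi> x" "\<psi> x"] by (simp add: distrib_right)
  then show ?thesis
    using assms by (auto simp: dual_space_def bounded_linear_on_def algebra_simps intro!: exI[of _ "M + N"])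
qed

lemma dual_space_scale:
  assumes "\<phi> \<in> dual_space E"
  shows "(\<lambda>x. c * \<phi> x) \<in> dual_space E"
proof -
  obtain M where "\<And>x. x \<in> E \<Longrightarrow> \<bar>\<phi> x\<bar> \<le> M * norm x"
    using dual_space_bounded[OF assms] by blast
  then have "\<bar>c * \<phi> x\<bar> \<le> (\<bar>c\<bar> * M) * norm x" if "x \<in> E" for x
    using that by (simp add: abs_mult mult.assoc mult_left_mono)
  then show ?thesis
    using assms
    by (auto simp: dual_space_def bounded_linear_on_def algebra_simps intro!: exI[of _ "\<bar>c\<bar> * M"])
qed

lemma dual_space_zero: "(\<lambda>x. 0) \<in> dual_space E"
  by (auto simp: dual_space_def bounded_linear_on_def intro!: exI[of _ 0])

lemma dual_space_sum:
  assumes "subspace E" "\<And>i. i \<in> I \<Longrightarrow> \<phi> i \<in> dual_space E"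
  shows "(\<lambda>x. \<Sum>i\<in>I. c i * \<phi> i x) \<in> dual_space E"
  using assms(2)
  by (induction I rule: infinite_finite_induct)
    (simp_all add: dual_space_zero dual_space_add[OF assms(1)] dual_space_scale)

lemma dual_norm_le:
  assumes "subspace E" "\<And>x. x \<in> E \<Longrightarrow> norm x \<le> 1 \<Longrightarrow> \<bar>\<phi> x\<bar> \<le> b"
  shows "dual_norm E \<phi> \<le> b"
  unfolding dual_norm_def
proof (rule cSUP_least)
  show "{x \<in> E. norm x \<le> 1} \<noteq> {}"
    using subspace_0[OF assms(1)] by (auto intro!: exI[of _ 0])
qed (use assms(2) in auto)

text \<open>The subspace is the linear span of the sequence; combinations with rational coefficients are dense
in it because the functionals have norm at most \<open>1\<close>.\<close>

lemma sequence_in_dual_ball_in_separable_subspace: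
  fixes \<phi> :: "nat \<Rightarrow> 'e::real_normed_vector \<Rightarrow> real"
  assumes E: "subspace E" and \<phi>: "\<And>i. \<phi> i \<in> dual_unit_ball E"
  obtains G where "dual_subspace E G" "dual_norm_separable E G" "range \<phi> \<subseteq> G"
proof -
  define comb where "comb n c = (\<lambda>x. \<Sum>i<n. c i * \<phi> i x)" for n :: nat and c :: "nat \<Rightarrow> real"
  define G where "G = {comb n c | n c. True}"
  define D where "D = range (\<lambda>qs :: rat list. comb (length qs) (\<lambda>i. of_rat (qs ! i)))"
  have \<phi>': "\<phi> i \<in> dual_space E" for i
    using \<phi> by (simp add: dual_unit_ball_def)
  have \<phi>1: "\<bar>\<phi> i x\<bar> \<le> 1" if "x \<in> E" "norm x \<le> 1" for i x
  proof -
    obtain M where M: "\<And>x. x \<in> E \<Longrightarrow> \<bar>\<phi> i x\<bar> \<le> M * norm x"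
      using dual_space_bounded[OF \<phi>'] by blast
    have "\<bar>\<phi> i y\<bar> \<le> \<bar>M\<bar>" if "y \<in> {x \<in> E. norm x \<le> 1}" for y
    proof -
      have "\<bar>\<phi> i y\<bar> \<le> \<bar>M\<bar> * norm y"
        using that M[of y] mult_right_mono[OF abs_ge_self[of M] norm_ge_zero[of y]] by auto
      also have "\<dots> \<le> \<bar>M\<bar> * 1"
        using that by (intro mult_left_mono) auto
      finally show ?thesis by simp
    qed
    then have "\<bar>\<phi> i x\<bar> \<le> dual_norm E (\<phi> i)"
      unfolding dual_norm_def using that by (intro cSUP_upper bdd_aboveI2) auto
    then show ?thesis
      using \<phi>[of i] by (simp add: dual_unit_ball_def)
  qed
  have pad: "comb n c = comb m (\<lambda>i. if i < n then c i else 0)" if "n \<le> m" for n m c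
    unfolding comb_def
  proof
    fix x
    have "(\<Sum>i<m. (if i < n then c i else 0) * \<phi> i x) = (\<Sum>i<n. (if i < n then c i else 0) * \<phi> i x)"
      using that by (intro sum.mono_neutral_right) auto
    then show "(\<Sum>i<n. c i * \<phi> i x) = (\<Sum>i<m. (if i < n then c i else 0) * \<phi> i x)"
      by simp
  qed
  show ?thesis
  proof (rule that)
    show "dual_subspace E G"
      unfolding dual_subspace_def
    proof (intro conjI ballI allI)
      show "G \<subseteq> dual_space E"
        using dual_space_sum[OF E \<phi>'] by (auto simp: G_def comb_def)
      show "(\<lambda>x. 0) \<in> G"
        by (auto simp: G_def comb_def intro!: exI[of _ 0])
      show "(\<lambda>x. \<psi> x + \<xi> x) \<in> G" if G2: "\<psi> \<in> G" "\<xi> \<in> G" for \<psi> \<xi>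
      proof -
        obtain n c m d where "\<psi> = comb n c" "\<xi> = comb m d"
          using G2 by (auto simp: G_def)
        then have "\<psi> = comb (max n m) (\<lambda>i. if i < n then c i else 0)"
            "\<xi> = comb (max n m) (\<lambda>i. if i < m then d i else 0)"
          using pad[of n "max n m" c] pad[of m "max n m" d] by simp_all
        then have "(\<lambda>x. \<psi> x + \<xi> x) =
            comb (max n m) (\<lambda>i. (if i < n then c i else 0) + (if i < m then d i else 0))"
          by (simp add: comb_def sum.distrib distrib_right)
        then show ?thesis
          by (auto simp: G_def)
      qed
      show "(\<lambda>x. c * \<psi> x) \<in> G" if G1: "\<psi> \<in> G" for c \<psi>
      proof -
        obtain n d where "\<psi> = comb n d"
          using G1 by (auto simp: G_def)
        then have "(\<lambda>x. c * \<psi> x) = comb n (\<lambda>i. c * d i)"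
          by (simp add: comb_def sum_distrib_left mult.assoc)
        then show ?thesis
          by (auto simp: G_def)
      qed
    qed
    show "dual_norm_separable E G"
      unfolding dual_norm_separable_def
    proof (intro exI[of _ D] conjI ballI allI impI)
      show "countable D" "D \<subseteq> G"
        by (auto simp: D_def G_def)
      fix \<psi> and e :: real assume "\<psi> \<in> G" "e > 0"
      then obtain n c where \<psi>: "\<psi> = comb n c"
        by (auto simp: G_def)
      define d where "d = e / (real n + 1)"
      have "d > 0" "(real n + 1) * d = e"
        using \<open>e > 0\<close> by (auto simp: d_def)
      then have d: "d > 0" "real n * d < e"
        by (auto simp: distrib_right)
      have "\<exists>q. \<bar>c i - of_rat q\<bar> < d" for i
      proof -
        obtain q where "c i < of_rat q" "of_rat q < c i + d"
          using of_rat_dense[of "c i" "c i + d"] d(1) by auto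
        then show ?thesis
          by (intro exI[of _ q]) linarith
      qed
      then obtain q where q: "\<And>i. \<bar>c i - of_rat (q i)\<bar> < d"
        by metis
      have D: "comb n (\<lambda>i. of_rat (q i)) \<in> D"
        unfolding D_def by (rule range_eqI[of _ _ "map q [0..<n]"]) (simp add: comb_def)
      have "dual_norm E (\<lambda>x. \<psi> x - comb n (\<lambda>i. of_rat (q i)) x) \<le> real n * d"
      proof (rule dual_norm_le[OF E])
        fix x assume x: "x \<in> E" "norm x \<le> 1"
        have "\<psi> x - comb n (\<lambda>i. of_rat (q i)) x = (\<Sum>i<n. (c i - of_rat (q i)) * \<phi> i x)"
          by (simp add: \<psi> comb_def sum_subtractf left_diff_distrib)
        also have "\<bar>\<dots>\<bar> \<le> (\<Sum>i<n. \<bar>(c i - of_rat (q i)) * \<phi> i x\<bar>)"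
          by (rule sum_abs)
        also have "\<dots> \<le> (\<Sum>i<n. d * 1)"
        proof (rule sum_mono)
          fix i
          show "\<bar>(c i - of_rat (q i)) * \<phi> i x\<bar> \<le> d * 1"
            unfolding abs_mult using q[of i] \<phi>1[OF x, of i] d(1) by (intro mult_mono) auto
        qed
        finally show "\<bar>\<psi> x - comb n (\<lambda>i. of_rat (q i)) x\<bar> \<le> real n * d"
          by simp
      qed
      then show "\<exists>\<xi>\<in>D. dual_norm E (\<lambda>x. \<psi> x - \<xi> x) < e"
        using D d(2) by (intro bexI[of _ "comb n (\<lambda>i. of_rat (q i))"]) auto
    qed
    have "\<phi> i = comb (Suc i) (\<lambda>j. if j = i then 1 else 0)" for i
      by (simp add: comb_def fun_eq_iff if_distrib[of "\<lambda>a. a * _"] cong: if_cong)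
    then show "range \<phi> \<subseteq> G"
      by (auto simp: G_def)
  qed
qed

text \<open>Apply the property to \<open>F = {0}\<close> and to the span \<open>G\<close> of the evaluations at the points of \<open>B\<close>. That \<open>G\<close>
lies in the image of the adjoint of \<open>P\<close> says that \<open>P f = f\<close> on \<open>B\<close> for all \<open>f\<close>. The images under \<open>P\<close> of the
characteristic functions of the members that meet \<open>B\<close> in an infinite set are then at distance at least \<open>1\<close>
from each other, and a separable image has no room for uncountably many of them.\<close>

lemma not_controlled_SCP:
  assumes ad: "almost_disjoint_family \<A>" and nls: "\<not> locally_small \<A>"
  shows "\<not> controlled_SCP (CK \<A>)"
proof
  assume SCP: "controlled_SCP (CK \<A>)"
  obtain B where B: "countable B" "B \<subseteq> \<Union>\<A>" "uncountable {A \<in> \<A>. infinite (A \<inter> B)}"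
    using nls by (rule not_locally_smallE)
  define \<A>' where "\<A>' = {A \<in> \<A>. infinite (A \<inter> B)}"
  have "B \<noteq> {}"
  proof
    assume "B = {}"
    then show False using B(3) by simp
  qed
  have "\<And>i. point_eval \<A> (Pt (from_nat_into B i)) \<in> dual_unit_ball (CK \<A>)"
    by (rule point_eval_in_dual_ball)
  then obtain G where G: "dual_subspace (CK \<A>) G" "dual_norm_separable (CK \<A>) G"
    "range (\<lambda>i. point_eval \<A> (Pt (from_nat_into B i))) \<subseteq> G"
    by (rule sequence_in_dual_ball_in_separable_subspace[OF subspace_C_space])
  have "subspace {0 :: 'a kpoint discrete \<Rightarrow>\<^sub>C real}" "{0} \<subseteq> CK \<A>"
    "separable_space (top_of_set {0 :: 'a kpoint discrete \<Rightarrow>\<^sub>C real})"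
    by (auto simp: CK_closed(4) separable_top_of_set_iff intro!: exI[of _ "{0}"])
  then obtain P where P: "projection_on (CK \<A>) P" "G \<subseteq> adjoint_on (CK \<A>) P ` dual_space (CK \<A>)"
    "separable_space (top_of_set (P ` CK \<A>))"
    using SCP G(1,2) unfolding controlled_SCP_def by blast
  have P_val: "K_val (P f) (Pt b) = K_val f (Pt b)" if "b \<in> B" "f \<in> CK \<A>" for b f
  proof -
    have "point_eval \<A> (Pt b) \<in> G"
      using G(3) range_from_nat_into[OF \<open>B \<noteq> {}\<close> B(1)] that(1) by (metis rangeE rangeI subsetD)
    then obtain \<psi> where \<psi>: "point_eval \<A> (Pt b) = adjoint_on (CK \<A>) P \<psi>"
      using P(2) by blast
    have "P f \<in> CK \<A>" "P (P f) = P f"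
      using P(1) that(2) by (auto simp: projection_on_def)
    then show ?thesis
      using fun_cong[OF \<psi>, of f] fun_cong[OF \<psi>, of "P f"] that(2)
      by (simp add: point_eval_def adjoint_on_def)
  qed
  have "countable \<A>'"
  proof (rule separable_isolated_subset_countable[OF P(3), where g = "\<lambda>A. P (CK_indicator A)" and d = 1])
    show "P (CK_indicator A) \<in> P ` CK \<A>" if "A \<in> \<A>'" for A
      using that CK_indicator_in_CK[OF ad] by (simp add: \<A>'_def)
    fix A A' assume A: "A \<in> \<A>'" "A' \<in> \<A>'" "A \<noteq> A'"
    then have "infinite (A \<inter> B)" "finite (A \<inter> A')"
      using ad by (auto simp: \<A>'_def almost_disjoint_family_def)
    then obtain b where b: "b \<in> A \<inter> B" "b \<notin> A'"
      by (metis IntI finite_subset IntD1 subsetI)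
    have "K_val (P (CK_indicator A)) (Pt b) = 1" "K_val (P (CK_indicator A')) (Pt b) = 0"
      using A b CK_indicator_in_CK[OF ad] by (simp_all add: \<A>'_def P_val K_val_CK_indicator)
    then show "1 \<le> dist (P (CK_indicator A)) (P (CK_indicator A'))"
      using abs_K_val_le[of "P (CK_indicator A) - P (CK_indicator A')" "Pt b"] by (simp add: dist_norm)
  qed simp
  then show False
    using B(3) by (simp add: \<A>'_def)
qed

section \<open>Failure of the weak Lindelof property\<close>

text \<open>Merely failing to be locally small does not obviously yield uncountably many characteristic functions that
have no weak accumulation point: their traces on \<open>B\<close> could crowd around finite subsets of \<open>B\<close>. Finite
levels that every member has to meet keep them away from finite sets.\<close>

definition levelled :: "'a set set \<Rightarrow> (nat \<Rightarrow> 'a set) \<Rightarrow> bool" where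
  "levelled \<A> L \<longleftrightarrow> (\<forall>n. finite (L n)) \<and> (\<forall>m n. m \<noteq> n \<longrightarrow> L m \<inter> L n = {}) \<and>
     (\<forall>A\<in>\<A>. \<forall>n. A \<inter> L n \<noteq> {})"

lemma levelledD:
  assumes "levelled \<A> L"
  shows "finite (L n)" "m \<noteq> n \<Longrightarrow> L m \<inter> L n = {}" "A \<in> \<A> \<Longrightarrow> A \<inter> L n \<noteq> {}"
  using assms by (auto simp: levelled_def)

text \<open>Disjointness of the levels lets a finite set meet only finitely many of them.\<close>

lemma levelled_avoids_finite:
  assumes L: "levelled \<A> L" and T: "finite T"
  shows "\<exists>n. L n \<inter> T = {}"
proof (rule ccontr)
  assume "\<nexists>n. L n \<inter> T = {}"
  then have "\<forall>n. \<exists>t. t \<in> L n \<inter> T"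
    by blast
  then obtain t where t: "\<And>n. t n \<in> L n \<inter> T"
    by metis
  have "inj t"
  proof (rule injI, rule ccontr)
    fix m n assume "t m = t n" "m \<noteq> n"
    then show False
      using t[of m] t[of n] levelledD(2)[OF L, of m n] by auto
  qed
  then have "infinite (range t)"
    by (simp add: finite_image_iff)
  moreover have "range t \<subseteq> T"
    using t by auto
  ultimately show False
    using T finite_subset by blast
qed

lemma not_locally_small_if_levelled:
  assumes L: "levelled \<A> L" and "uncountable \<A>"
  shows "\<not> locally_small \<A>"
proof
  assume ls: "locally_small \<A>"
  let ?B = "(\<Union>n. L n) \<inter> \<Union>\<A>"
  have "countable ?B"
    using levelledD(1)[OF L] by (intro countable_Int1 countable_UN) (auto simp: countable_finite)
  then have "countable {A \<in> \<A>. infinite (A \<inter> ?B)}"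
    using ls[unfolded locally_small_def, rule_format, of ?B] by blast
  moreover have "infinite (A \<inter> ?B)" if A: "A \<in> \<A>" for A
  proof
    assume "finite (A \<inter> ?B)"
    then obtain n where "L n \<inter> (A \<inter> ?B) = {}"
      using levelled_avoids_finite[OF L] by blast
    then show False
      using levelledD(3)[OF L A, of n] A by blast
  qed
  then have "{A \<in> \<A>. infinite (A \<inter> ?B)} = \<A>"
    by blast
  ultimately show False
    using assms(2) by simp
qed

lemma openin_weak:
  assumes "\<phi> \<in> dual_space E" "open U"
  shows "openin (weak_topology E) {f \<in> E. \<phi> f \<in> U}"
  unfolding weak_topology_def using assms by (intro topology_generated_by_Basis) blast

lemma openin_weak_CK:
  assumes "open U"
  shows "openin (weak_topology (CK \<A>)) {f \<in> CK \<A>. K_val f x \<in> U}"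
proof -
  have "{f \<in> CK \<A>. K_val f x \<in> U} = {f \<in> CK \<A>. point_eval \<A> x f \<in> U}"
    by (auto simp: point_eval_def)
  then show ?thesis
    using openin_weak[OF point_eval_in_dual assms] by simp
qed

lemma topspace_weak_CK: "topspace (weak_topology (CK \<A>)) = CK \<A>"
proof
  show "topspace (weak_topology (CK \<A>)) \<subseteq> CK \<A>"
    unfolding weak_topology_def topology_generated_by_topspace by blast
  show "CK \<A> \<subseteq> topspace (weak_topology (CK \<A>))"
    using openin_subset[OF openin_weak_CK[OF open_UNIV, of \<A> Infty]] by simp
qed

text \<open>A continuous function that vanishes at \<open>\<infinity>\<close> is small off finitely many of the sets
\<open>{l\<^sub>A} \<union> A\<close>; if it also vanishes at \<open>l\<^sub>A\<close>, it is small at almost all points of each of them.\<close>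

lemma finite_large_points:
  assumes f: "f \<in> CK \<A>" and zero: "K_val f Infty = 0" "\<And>A. A \<in> \<A> \<Longrightarrow> K_val f (LimPt A) = 0" and "e > 0"
  shows "finite {p. e \<le> \<bar>K_val f (Pt p)\<bar>}"
proof -
  obtain \<F> where \<F>: "finite \<F>" "\<F> \<subseteq> \<A>"
    "{x \<in> K_points \<A>. e \<le> \<bar>K_val f x - K_val f Infty\<bar>} \<subseteq> (\<Union>A\<in>\<F>. K_nbhd A)"
    using CK_near_Infty[OF f \<open>e > 0\<close>] by blast
  have "finite (\<Union>A\<in>\<F>. {p \<in> A. e \<le> \<bar>K_val f (Pt p) - K_val f (LimPt A)\<bar>})"
    using \<F>(1,2) CK_cofinite_at_LimPt[OF f _ \<open>e > 0\<close>] by blast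
  moreover have "{p. e \<le> \<bar>K_val f (Pt p)\<bar>} \<subseteq>
      (\<Union>A\<in>\<F>. {p \<in> A. e \<le> \<bar>K_val f (Pt p) - K_val f (LimPt A)\<bar>})"
  proof
    fix p assume p: "p \<in> {p. e \<le> \<bar>K_val f (Pt p)\<bar>}"
    then have "Pt p \<in> K_points \<A>"
      using CK_outside[OF f, of "Pt p"] \<open>e > 0\<close> by fastforce
    then have "Pt p \<in> (\<Union>A\<in>\<F>. K_nbhd A)"
      using p \<F>(3) zero(1) by (intro subsetD[OF \<F>(3)]) simp
    then show "p \<in> (\<Union>A\<in>\<F>. {p \<in> A. e \<le> \<bar>K_val f (Pt p) - K_val f (LimPt A)\<bar>})"
      using p zero(2) \<F>(2) by (auto simp: subset_iff intro!: bexI)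
  qed
  ultimately show ?thesis
    using finite_subset by blast
qed

text \<open>If \<open>g\<close> does not vanish at some \<open>l\<^sub>A\<close> or at \<open>\<infinity>\<close>, that point alone separates \<open>g\<close> from the characteristic
functions of all other members. Otherwise \<open>g\<close> is large only at finitely many points, so it is small on some
level, whereas every characteristic function of a member takes the value \<open>1\<close> on that level.\<close>

lemma weak_nbhd_with_countably_many_indicators:
  assumes L: "levelled \<A> L" and g: "g \<in> CK \<A>"
  obtains U where "openin (weak_topology (CK \<A>)) U" "g \<in> U" "countable {A \<in> \<A>. CK_indicator A \<in> U}"
proof (cases "K_val g Infty = 0 \<and> (\<forall>A\<in>\<A>. K_val g (LimPt A) = 0)")
  case False
  then obtain x where x: "x = Infty \<or> x \<in> LimPt ` \<A>" "K_val g x \<noteq> 0"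
    by auto
  obtain B where "\<And>A. x \<in> K_nbhd A \<Longrightarrow> A = B"
    using x(1) by (metis imageE mem_K_nbhd(2,3))
  then have "{A \<in> \<A>. K_val (CK_indicator A) x \<noteq> 0} \<subseteq> {B}"
    by (auto simp: K_val_CK_indicator indicator_def split: if_splits)
  then have "countable {A \<in> \<A>. K_val (CK_indicator A) x \<noteq> 0}"
    by (rule countable_subset) simp
  moreover have "{A \<in> \<A>. CK_indicator A \<in> {f \<in> CK \<A>. K_val f x \<in> - {0}}}
      \<subseteq> {A \<in> \<A>. K_val (CK_indicator A) x \<noteq> 0}"
    by auto
  ultimately show ?thesis
    using that[OF openin_weak_CK[of "- {0}" \<A> x]] g x(2) countable_subset by auto
next
  case True
  define T where "T = {p. 1/2 \<le> \<bar>K_val g (Pt p)\<bar>}"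
  have "finite T"
    unfolding T_def using True g by (intro finite_large_points) auto
  then obtain n where n: "L n \<inter> T = {}"
    using levelled_avoids_finite[OF L] by blast
  define U where "U = (\<Inter>p\<in>L n. {f \<in> CK \<A>. K_val f (Pt p) \<in> {..<1/2}}) \<inter> CK \<A>"
  show ?thesis
  proof (rule that)
    have "openin (weak_topology (CK \<A>))
        ((\<Inter>p\<in>L n. {f \<in> CK \<A>. K_val f (Pt p) \<in> {..<1/2}}) \<inter> topspace (weak_topology (CK \<A>)))"
      using levelledD(1)[OF L] by (rule openin_INT) (rule openin_weak_CK[OF open_lessThan])
    then show "openin (weak_topology (CK \<A>)) U"
      by (simp only: U_def topspace_weak_CK)
    have "K_val g (Pt p) < 1/2" if "p \<in> L n" for p
      using that n by (auto simp: T_def disjoint_iff)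
    then show "g \<in> U"
      using g by (auto simp: U_def)
    have "{A \<in> \<A>. CK_indicator A \<in> U} = {}"
    proof -
      have "CK_indicator A \<notin> U" if A: "A \<in> \<A>" for A
      proof -
        obtain p where p: "p \<in> A" "p \<in> L n"
          using levelledD(3)[OF L A, of n] by blast
        then have "K_val (CK_indicator A) (Pt p) = 1"
          by (simp add: K_val_CK_indicator)
        then show ?thesis
          using p(2) by (force simp: U_def)
      qed
      then show ?thesis by blast
    qed
    then show "countable {A \<in> \<A>. CK_indicator A \<in> U}"
      by (metis countable_empty)
  qed
qed

lemma not_weakly_Lindelof:
  assumes "almost_disjoint_family \<A>" "uncountable \<A>" and L: "levelled \<A> L"
  shows "\<not> Lindelof_space (weak_topology (CK \<A>))"
proof
  assume Lin: "Lindelof_space (weak_topology (CK \<A>))"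
  define \<U> where "\<U> = {U. openin (weak_topology (CK \<A>)) U \<and> countable {A \<in> \<A>. CK_indicator A \<in> U}}"
  have "CK \<A> \<subseteq> \<Union>\<U>"
  proof
    fix g assume g: "g \<in> CK \<A>"
    obtain U where "openin (weak_topology (CK \<A>)) U" "g \<in> U" "countable {A \<in> \<A>. CK_indicator A \<in> U}"
      by (rule weak_nbhd_with_countably_many_indicators[OF L g])
    then show "g \<in> \<Union>\<U>"
      by (auto simp: \<U>_def)
  qed
  moreover have "openin (weak_topology (CK \<A>)) U" if "U \<in> \<U>" for U
    using that by (simp add: \<U>_def)
  ultimately obtain \<V> where V: "countable \<V>" "\<V> \<subseteq> \<U>" "CK \<A> \<subseteq> \<Union>\<V>"
    using Lin[unfolded Lindelof_space_alt topspace_weak_CK, rule_format, of \<U>] by auto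
  have "\<A> \<subseteq> (\<Union>U\<in>\<V>. {A \<in> \<A>. CK_indicator A \<in> U})"
  proof
    fix A assume A: "A \<in> \<A>"
    then have "CK_indicator A \<in> \<Union>\<V>"
      using V(3) CK_indicator_in_CK[OF assms(1)] by blast
    then show "A \<in> (\<Union>U\<in>\<V>. {A \<in> \<A>. CK_indicator A \<in> U})"
      using A by auto
  qed
  moreover have "countable (\<Union>U\<in>\<V>. {A \<in> \<A>. CK_indicator A \<in> U})"
    using V(1,2) by (intro countable_UN) (auto simp: \<U>_def)
  ultimately show False
    using assms(2) countable_subset by blast
qed

section \<open>Mirrored families and separable complementation\<close>

text \<open>Near \<open>\<infinity>\<close>, for each \<open>1/(n+1)\<close>, only finitely many of the countable sets \<open>{l\<^sub>A} \<union> A\<close> are exceptional.\<close>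

lemma countable_support_CK:
  assumes f: "f \<in> CK \<A>" and "\<And>A. A \<in> \<A> \<Longrightarrow> countable A"
  shows "countable {x \<in> K_points \<A>. K_val f x \<noteq> K_val f Infty}"
proof -
  have "countable {x \<in> K_points \<A>. 1 / Suc n \<le> \<bar>K_val f x - K_val f Infty\<bar>}" for n
  proof -
    obtain \<F> where "finite \<F>" "\<F> \<subseteq> \<A>" and
      sub: "{x \<in> K_points \<A>. 1 / Suc n \<le> \<bar>K_val f x - K_val f Infty\<bar>} \<subseteq> (\<Union>A\<in>\<F>. K_nbhd A)"
      by (rule CK_near_Infty[OF f, of "1 / Suc n"]) auto
    then have "countable (\<Union>A\<in>\<F>. K_nbhd A)"
      using assms(2) unfolding K_nbhd_def by (intro countable_UN) (auto simp: countable_finite)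
    then show ?thesis
      using sub countable_subset by blast
  qed
  then have "countable (\<Union>n. {x \<in> K_points \<A>. 1 / Suc n \<le> \<bar>K_val f x - K_val f Infty\<bar>})"
    by blast
  moreover have "{x \<in> K_points \<A>. K_val f x \<noteq> K_val f Infty} \<subseteq>
      (\<Union>n. {x \<in> K_points \<A>. 1 / Suc n \<le> \<bar>K_val f x - K_val f Infty\<bar>})"
  proof
    fix x assume x: "x \<in> {x \<in> K_points \<A>. K_val f x \<noteq> K_val f Infty}"
    then obtain n where "1 / Suc n < \<bar>K_val f x - K_val f Infty\<bar>"
      using nat_approx_posE[of "\<bar>K_val f x - K_val f Infty\<bar>"] by auto
    then show "x \<in> (\<Union>n. {x \<in> K_points \<A>. 1 / Suc n \<le> \<bar>K_val f x - K_val f Infty\<bar>})"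
      using x by (auto intro!: exI[of _ n])
  qed
  ultimately show ?thesis
    using countable_subset by blast
qed

definition CK_supported_on :: "'a set set \<Rightarrow> 'a kpoint set \<Rightarrow> ('a kpoint discrete \<Rightarrow>\<^sub>C real) set" where
  "CK_supported_on \<A> S = {f \<in> CK \<A>. \<forall>x\<in>K_points \<A> - S. K_val f x = K_val f Infty}"

text \<open>The approximating functions \<open>v q\<close> need not belong to \<open>S\<close>; choosing one element of \<open>S\<close> close to each of them
produces a dense subset inside \<open>S\<close>.\<close>

lemma separable_if_uniformly_approximable:
  fixes S :: "('k discrete \<Rightarrow>\<^sub>C real) set" and v :: "'c \<Rightarrow> 'k \<Rightarrow> real"
  assumes Q: "countable Q"
    and approx: "\<And>f e. f \<in> S \<Longrightarrow> e > 0 \<Longrightarrow> \<exists>q\<in>Q. \<forall>x. \<bar>K_val f x - v q x\<bar> \<le> e"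
  shows "separable_space (top_of_set S)"
proof -
  define near where "near q n f \<longleftrightarrow> f \<in> S \<and> (\<forall>x. \<bar>K_val f x - v q x\<bar> \<le> 1 / Suc n)" for q n f
  define I where "I = {(q, n). q \<in> Q \<and> (\<exists>f. near q n f)}"
  define g where "g = (\<lambda>(q, n). SOME f. near q n f)"
  have g: "near q n (g (q, n))" if "(q, n) \<in> I" for q n
    using that someI_ex[of "near q n"] by (auto simp: I_def g_def)
  show ?thesis
    unfolding separable_top_of_set_iff
  proof (intro exI[of _ "g ` I"] conjI ballI allI impI)
    have "I \<subseteq> Q \<times> UNIV"
      by (auto simp: I_def)
    then show "countable (g ` I)"
      using Q by (meson countable_SIGMA countable_image countable_subset countableI_type)
    show "g ` I \<subseteq> S"
      using g by (auto simp: near_def)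
    fix f and e :: real assume f: "f \<in> S" and "e > 0"
    then obtain n where n: "1 / Suc n < e / 2"
      using nat_approx_posE[of "e / 2"] by auto
    obtain q where q: "q \<in> Q" "\<And>x. \<bar>K_val f x - v q x\<bar> \<le> 1 / Suc n"
      using approx[OF f, of "1 / Suc n"] by auto
    then have "(q, n) \<in> I"
      using f by (auto simp: I_def near_def)
    have "norm (g (q, n) - f) \<le> 2 * (1 / Suc n)"
    proof (rule norm_le_K_val)
      fix x
      have "\<bar>K_val (g (q, n)) x - v q x\<bar> \<le> 1 / Suc n"
        using g[OF \<open>(q, n) \<in> I\<close>] by (simp add: near_def)
      then show "\<bar>K_val (g (q, n) - f) x\<bar> \<le> 2 * (1 / Suc n)"
        unfolding K_val_arith using q(2)[of x] by linarith
    qed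
    then have "dist (g (q, n)) f < e"
      unfolding dist_norm using n by linarith
    then show "\<exists>c\<in>g ` I. dist c f < e"
      using \<open>(q, n) \<in> I\<close> by blast
  qed
qed

text \<open>A list of pairs of a set and a number codes a step function, in which earlier entries override
later ones. This makes it possible to correct a step function on a set by putting entries in front, whether or not
the sets overlap.\<close>

primrec step_val :: "('b set \<times> real) list \<Rightarrow> 'b \<Rightarrow> real" where
  "step_val [] x = 0"
| "step_val (p # l) x = (if x \<in> fst p then snd p else step_val l x)"

lemma step_val_extend:
  assumes "finite I" "l \<in> lists (\<C> \<times> \<rat>)" "\<And>i. i \<in> I \<Longrightarrow> U i \<in> \<C>" "e > 0"
  obtains l' where "l' \<in> lists (\<C> \<times> \<rat>)"
    "\<And>x. (\<exists>i\<in>I. x \<in> U i \<and> \<bar>step_val l' x - r i\<bar> < e) \<or> x \<notin> (\<Union>i\<in>I. U i) \<and> step_val l' x = step_val l x"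
proof -
  have "\<exists>l'\<in>lists (\<C> \<times> \<rat>). \<forall>x. (\<exists>i\<in>I. x \<in> U i \<and> \<bar>step_val l' x - r i\<bar> < e) \<or>
      x \<notin> (\<Union>i\<in>I. U i) \<and> step_val l' x = step_val l x"
    using assms(1,3)
  proof (induction I rule: finite_induct)
    case empty
    then show ?case
      using assms(2) by auto
  next
    case (insert j I)
    then obtain l' where l': "l' \<in> lists (\<C> \<times> \<rat>)" "\<And>x. (\<exists>i\<in>I. x \<in> U i \<and> \<bar>step_val l' x - r i\<bar> < e) \<or>
      x \<notin> (\<Union>i\<in>I. U i) \<and> step_val l' x = step_val l x"
      by auto
    obtain q where q: "q \<in> \<rat>" "r j < q" "q < r j + e"
      using Rats_dense_in_real[of "r j" "r j + e"] assms(4) by auto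
    show ?case
    proof (intro bexI[of _ "(U j, q) # l'"] allI)
      fix x
      show "(\<exists>i\<in>insert j I. x \<in> U i \<and> \<bar>step_val ((U j, q) # l') x - r i\<bar> < e) \<or>
        x \<notin> (\<Union>i\<in>insert j I. U i) \<and> step_val ((U j, q) # l') x = step_val l x"
        using q l'(2)[of x] by (cases "x \<in> U j") auto
    qed (use l'(1) q insert.prems in auto)
  qed
  then show ?thesis
    using that by auto
qed

text \<open>Such a function is uniformly approximated by a step function built in three layers, from back to front: its
value at \<open>\<infinity>\<close> on all of \<open>K\<close>; its value at \<open>l\<^sub>A\<close> on \<open>{l\<^sub>A} \<union> A\<close> for finitely many \<open>A \<in> \<S>\<close>; and its
own values at the finitely many points of \<open>X\<close> where this is not yet good enough. With rational values and
sets from a countable collection there are only countably many such step functions.\<close>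

lemma separable_CK_supported_on:
  assumes \<S>: "countable \<S>" "\<S> \<subseteq> \<A>" and X: "countable X" "\<Union>\<S> \<subseteq> X"
  shows "separable_space (top_of_set (CK_supported_on \<A> (Pt ` X \<union> LimPt ` \<S>)))"
proof -
  define \<C> where "\<C> = insert (K_points \<A>) (K_nbhd ` \<S> \<union> (\<lambda>p. {Pt p}) ` X)"
  have "countable \<C>"
    using \<S>(1) X(1) by (simp add: \<C>_def)
  then have "countable (lists (\<C> \<times> \<rat>))"
    using countable_rat by (intro countable_lists countable_SIGMA)
  then show ?thesis
  proof (rule separable_if_uniformly_approximable[where v = step_val])
    fix f and e :: real
    assume "f \<in> CK_supported_on \<A> (Pt ` X \<union> LimPt ` \<S>)" and "e > 0"
    then have f: "f \<in> CK \<A>"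
      and off: "\<And>x. x \<in> K_points \<A> - (Pt ` X \<union> LimPt ` \<S>) \<Longrightarrow> K_val f x = K_val f Infty"
      by (auto simp: CK_supported_on_def)
    have f_Pt: "K_val f (Pt p) = K_val f Infty" if "p \<in> \<Union>\<A> - X" for p
      using that by (intro off) auto
    have f_Lim: "K_val f (LimPt A) = K_val f Infty" if "A \<in> \<A> - \<S>" for A
      using that by (intro off) auto
    have e2: "e / 2 > 0"
      using \<open>e > 0\<close> by simp
    obtain \<F> where \<F>: "finite \<F>" "\<F> \<subseteq> \<A>"
      "{x \<in> K_points \<A>. e / 2 \<le> \<bar>K_val f x - K_val f Infty\<bar>} \<subseteq> (\<Union>A\<in>\<F>. K_nbhd A)"
      by (rule CK_near_Infty[OF f e2])
    define T where "T = (\<Union>A\<in>\<F>. {p \<in> A. e / 2 \<le> \<bar>K_val f (Pt p) - K_val f (LimPt A)\<bar>}) \<inter> X"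
    have T: "finite T"
      using \<F>(1,2) CK_cofinite_at_LimPt[OF f _ e2] by (auto simp: T_def)
    \<comment> \<open>The bottom layer extends the zero function, so that nothing changes outside \<open>K\<close>.\<close>
    obtain l0 where l0: "l0 \<in> lists (\<C> \<times> \<rat>)"
      "\<And>x. x \<in> K_points \<A> \<and> \<bar>step_val l0 x - K_val f Infty\<bar> < e / 2 \<or> x \<notin> K_points \<A> \<and> step_val l0 x = 0"
      by (rule step_val_extend[of "{()}" "[]" \<C> "\<lambda>_. K_points \<A>" "e / 2" "\<lambda>_. K_val f Infty"])
        (use e2 in \<open>auto simp: \<C>_def\<close>)
    obtain l1 where l1: "l1 \<in> lists (\<C> \<times> \<rat>)"
      "\<And>x. (\<exists>A\<in>\<F> \<inter> \<S>. x \<in> K_nbhd A \<and> \<bar>step_val l1 x - K_val f (LimPt A)\<bar> < e / 2) \<or>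
           x \<notin> (\<Union>A\<in>\<F> \<inter> \<S>. K_nbhd A) \<and> step_val l1 x = step_val l0 x"
      by (rule step_val_extend[of "\<F> \<inter> \<S>" l0 \<C> K_nbhd "e / 2" "\<lambda>A. K_val f (LimPt A)"])
        (use \<F>(1) l0(1) e2 in \<open>auto simp: \<C>_def\<close>)
    obtain l2 where l2: "l2 \<in> lists (\<C> \<times> \<rat>)"
      "\<And>x. (\<exists>p\<in>T. x \<in> {Pt p} \<and> \<bar>step_val l2 x - K_val f (Pt p)\<bar> < e) \<or>
           x \<notin> (\<Union>p\<in>T. {Pt p}) \<and> step_val l2 x = step_val l1 x"
      by (rule step_val_extend[of T l1 \<C> "\<lambda>p. {Pt p}" e "\<lambda>p. K_val f (Pt p)"])
        (use T l1(1) \<open>e > 0\<close> in \<open>auto simp: \<C>_def T_def\<close>)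
    have close: "\<bar>K_val f x - K_val f (LimPt A)\<bar> < e / 2"
      if "A \<in> \<F>" "x \<in> K_nbhd A" "x \<in> Pt ` X \<union> {LimPt A}" "x \<notin> Pt ` T" for A x
    proof (cases x)
      case (Pt p)
      then have "p \<notin> T" "p \<in> A" "p \<in> X"
        using that by auto
      then show ?thesis
        using Pt that(1) by (auto simp: T_def not_le)
    qed (use that e2 in auto)
    have "\<bar>K_val f x - step_val l2 x\<bar> \<le> e" for x
    proof (cases "x \<in> Pt ` T")
      case True
      then show ?thesis
        using l2(2)[of x] by (force simp: abs_minus_commute)
    next
      case False
      then have l21: "step_val l2 x = step_val l1 x"
        using l2(2)[of x] by auto
      show ?thesis
      proof (cases "x \<in> (\<Union>A\<in>\<F> \<inter> \<S>. K_nbhd A)")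
        case True
        then obtain A where A: "A \<in> \<F> \<inter> \<S>" "x \<in> K_nbhd A" "\<bar>step_val l1 x - K_val f (LimPt A)\<bar> < e / 2"
          using l1(2)[of x] by blast
        have "\<bar>K_val f x - K_val f (LimPt A)\<bar> < e / 2"
          using A(1,2) X(2) False by (intro close) (auto simp: K_nbhd_def)
        then show ?thesis
          using A(3) l21 by linarith
      next
        case nbhd: False
        then have l20: "step_val l2 x = step_val l0 x"
          using l1(2)[of x] l21 by auto
        show ?thesis
        proof (cases "x \<in> K_points \<A>")
          case outside: False
          then show ?thesis
            using l0(2)[of x] l20 CK_outside[OF f outside] \<open>e > 0\<close> by auto
        next
          case x: True
          have "\<bar>K_val f x - K_val f Infty\<bar> < e / 2"
          proof (rule ccontr)
            assume far: "\<not> \<bar>K_val f x - K_val f Infty\<bar> < e / 2"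
            then obtain A where A: "A \<in> \<F>" "x \<in> K_nbhd A"
              using x \<F>(3) by force
            then have "A \<in> \<A> - \<S>"
              using nbhd \<F>(2) by auto
            then have lim: "K_val f (LimPt A) = K_val f Infty"
              by (rule f_Lim)
            have "x \<in> Pt ` X"
            proof (cases x)
              case (Pt p)
              then have "p \<in> X"
                using far x e2 f_Pt[of p] by (cases "p \<in> X") auto
              then show ?thesis
                using Pt by simp
            qed (use far lim A(2) e2 in auto)
            then show False
              using close[OF A] False far lim by simp
          qed
          then show ?thesis
            using l0(2)[of x] x l20 by linarith
        qed
      qed
    qed
    then show "\<exists>l\<in>lists (\<C> \<times> \<rat>). \<forall>x. \<bar>K_val f x - step_val l x\<bar> \<le> e"
      using l2(1) by blast
  qed
qed

definition mirrored :: "'a set set \<Rightarrow> bool" where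
  "mirrored \<A> \<longleftrightarrow> (\<forall>\<R>. countable \<R> \<and> \<R> \<subseteq> \<A> \<longrightarrow>
     (\<exists>\<S> X \<phi>. countable \<S> \<and> \<R> \<subseteq> \<S> \<and> \<S> \<subseteq> \<A> \<and> countable X \<and> \<Union>\<S> \<subseteq> X \<and>
        inj_on \<phi> X \<and> \<phi> ` X \<inter> X = {} \<and>
        (\<forall>A\<in>\<A> - \<S>. finite {p \<in> X. (p \<in> A) \<noteq> (\<phi> p \<in> A)})))"

text \<open>The mirror image of a point of \<open>X\<close> need not lie in \<open>\<Union>\<A>\<close>. Points outside \<open>\<Union>\<A>\<close> are
treated as \<open>\<infinity>\<close>, so that \<open>f(p) - f(\<phi> p) + f(\<infinity>)\<close> becomes \<open>f(p)\<close>.\<close>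

definition val_or_Infty :: "'a set set \<Rightarrow> ('a kpoint discrete \<Rightarrow>\<^sub>C real) \<Rightarrow> 'a \<Rightarrow> real" where
  "val_or_Infty \<A> f q = K_val f (if q \<in> \<Union>\<A> then Pt q else Infty)"

fun mirror_fun ::
  "'a set set \<Rightarrow> 'a set set \<Rightarrow> 'a set \<Rightarrow> ('a \<Rightarrow> 'a) \<Rightarrow> ('a kpoint discrete \<Rightarrow>\<^sub>C real) \<Rightarrow> 'a kpoint \<Rightarrow> real"
where
  "mirror_fun \<A> \<S> X \<phi> f (Pt p) =
     (if p \<in> \<Union>\<A>
      then if p \<in> X then K_val f (Pt p) - val_or_Infty \<A> f (\<phi> p) + K_val f Infty else K_val f Infty
      else 0)"
| "mirror_fun \<A> \<S> X \<phi> f (LimPt A) =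
     (if A \<in> \<A> then if A \<in> \<S> then K_val f (LimPt A) else K_val f Infty else 0)"
| "mirror_fun \<A> \<S> X \<phi> f Infty = K_val f Infty"

definition mirror_proj ::
  "'a set set \<Rightarrow> 'a set set \<Rightarrow> 'a set \<Rightarrow> ('a \<Rightarrow> 'a) \<Rightarrow>
     ('a kpoint discrete \<Rightarrow>\<^sub>C real) \<Rightarrow> ('a kpoint discrete \<Rightarrow>\<^sub>C real)"
where "mirror_proj \<A> \<S> X \<phi> f = of_bounded (mirror_fun \<A> \<S> X \<phi> f)"

lemma abs_mirror_fun_le: "\<bar>mirror_fun \<A> \<S> X \<phi> f x\<bar> \<le> 3 * norm f"
proof (cases x)
  case (Pt p)
  have "\<bar>K_val f y - K_val f z + K_val f w\<bar> \<le> 3 * norm f" for y z w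
    using abs_K_val_le[of f y] abs_K_val_le[of f z] abs_K_val_le[of f w] by linarith
  then show ?thesis
    using Pt abs_K_val_le[of f Infty] by (auto simp: val_or_Infty_def)
next
  case (LimPt A)
  then show ?thesis
    using abs_K_val_le[of f x] abs_K_val_le[of f Infty] by auto
next
  case Infty
  then show ?thesis
    using abs_K_val_le[of f Infty] by auto
qed

lemma K_val_mirror_proj: "K_val (mirror_proj \<A> \<S> X \<phi> f) x = mirror_fun \<A> \<S> X \<phi> f x"
  unfolding mirror_proj_def by (rule K_val_of_bounded[OF abs_mirror_fun_le])

lemma mirror_proj_linear:
  "mirror_proj \<A> \<S> X \<phi> (f + g) = mirror_proj \<A> \<S> X \<phi> f + mirror_proj \<A> \<S> X \<phi> g"
  "mirror_proj \<A> \<S> X \<phi> (c *\<^sub>R f) = c *\<^sub>R mirror_proj \<A> \<S> X \<phi> f"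
proof -
  have "mirror_fun \<A> \<S> X \<phi> (f + g) x = mirror_fun \<A> \<S> X \<phi> f x + mirror_fun \<A> \<S> X \<phi> g x"
    "mirror_fun \<A> \<S> X \<phi> (c *\<^sub>R f) x = c * mirror_fun \<A> \<S> X \<phi> f x" for x
    by (cases x; simp add: val_or_Infty_def algebra_simps)+
  then show "mirror_proj \<A> \<S> X \<phi> (f + g) = mirror_proj \<A> \<S> X \<phi> f + mirror_proj \<A> \<S> X \<phi> g"
    "mirror_proj \<A> \<S> X \<phi> (c *\<^sub>R f) = c *\<^sub>R mirror_proj \<A> \<S> X \<phi> f"
    by (auto intro!: K_val_eqI simp: K_val_mirror_proj)
qed

locale mirror =
  fixes \<A> \<S> :: "'a set set" and X :: "'a set" and \<phi> :: "'a \<Rightarrow> 'a"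
  assumes ad: "almost_disjoint_family \<A>" and X: "\<Union>\<S> \<subseteq> X"
    and inj: "inj_on \<phi> X" and disj: "\<phi> ` X \<inter> X = {}"
    and mirror: "\<And>A. A \<in> \<A> - \<S> \<Longrightarrow> finite {p \<in> X. (p \<in> A) \<noteq> (\<phi> p \<in> A)}"
begin

lemma image_avoids: "A \<in> \<S> \<Longrightarrow> p \<in> X \<Longrightarrow> \<phi> p \<notin> A"
  using X disj by blast

lemma far_from_Infty:
  assumes f: "f \<in> CK \<A>" and e: "e > 0"
  obtains \<F> where "finite \<F>" "\<F> \<subseteq> \<A>"
    "\<And>x. x \<in> K_points \<A> \<Longrightarrow> e \<le> \<bar>K_val f x - K_val f Infty\<bar> \<Longrightarrow> x \<in> (\<Union>A\<in>\<F>. K_nbhd A)"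
    "\<And>q. e \<le> \<bar>val_or_Infty \<A> f q - K_val f Infty\<bar> \<Longrightarrow> q \<in> \<Union>\<F>"
proof -
  obtain \<F> where \<F>: "finite \<F>" "\<F> \<subseteq> \<A>"
    "{x \<in> K_points \<A>. e \<le> \<bar>K_val f x - K_val f Infty\<bar>} \<subseteq> (\<Union>A\<in>\<F>. K_nbhd A)"
    by (rule CK_near_Infty[OF f e])
  have near: "x \<in> (\<Union>A\<in>\<F>. K_nbhd A)" if "x \<in> K_points \<A>" "e \<le> \<bar>K_val f x - K_val f Infty\<bar>" for x
    using that \<F>(3) by blast
  have "q \<in> \<Union>\<F>" if "e \<le> \<bar>val_or_Infty \<A> f q - K_val f Infty\<bar>" for q
  proof -
    have "q \<in> \<Union>\<A>"
      using that e by (auto simp: val_or_Infty_def split: if_splits)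
    then have "Pt q \<in> (\<Union>A\<in>\<F>. K_nbhd A)"
      using that by (intro near) (auto simp: val_or_Infty_def)
    then show ?thesis by auto
  qed
  then show ?thesis
    using that \<F>(1,2) near by blast
qed

text \<open>Continuity at \<open>l\<^sub>A\<close> for \<open>A \<in> \<S>\<close> requires \<open>f(\<phi> p) \<rightarrow> f(\<infinity>)\<close> along \<open>A\<close>, and this holds because the mirror image
of \<open>A\<close> meets each member of the family in a finite set: members of \<open>\<S>\<close> are avoided by \<open>\<phi>\<close>, and for
others the mirror property leads back to \<open>A \<inter> B\<close>. At \<open>l\<^sub>A\<close> for \<open>A \<notin> \<S>\<close> both \<open>f(p)\<close> and \<open>f(\<phi> p)\<close> tend
to \<open>f(l\<^sub>A)\<close>, the latter because \<open>\<phi>\<close> is injective. At \<open>\<infinity>\<close> the exceptional points of the mirror property are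
covered by finitely many further members.\<close>

lemma mirror_proj_in_CK:
  assumes f: "f \<in> CK \<A>"
  shows "mirror_proj \<A> \<S> X \<phi> f \<in> CK \<A>"
  unfolding mirror_proj_def
proof (rule of_bounded_in_CK[OF abs_mirror_fun_le])
  show "mirror_fun \<A> \<S> X \<phi> f x = 0" if "x \<notin> K_points \<A>" for x
    using that by (cases x) auto
next
  fix e :: real and A assume "e > 0" and A: "A \<in> \<A>"
  then have e2: "e / 2 > 0" by simp
  obtain \<F> where \<F>: "finite \<F>" "\<F> \<subseteq> \<A>"
    "\<And>q. e / 2 \<le> \<bar>val_or_Infty \<A> f q - K_val f Infty\<bar> \<Longrightarrow> q \<in> \<Union>\<F>"
    by (rule far_from_Infty[OF f e2]) blast
  have N: "finite {p \<in> A. e / 2 \<le> \<bar>K_val f (Pt p) - K_val f (LimPt A)\<bar>}" (is "finite ?N")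
    by (rule CK_cofinite_at_LimPt[OF f A e2])
  show "finite {p \<in> A. e \<le> \<bar>mirror_fun \<A> \<S> X \<phi> f (Pt p) - mirror_fun \<A> \<S> X \<phi> f (LimPt A)\<bar>}"
  proof (cases "A \<in> \<S>")
    case True
    have "finite {p \<in> A. \<phi> p \<in> B}" if "B \<in> \<F>" for B
    proof (cases "B \<in> \<S>")
      case B: True
      then have "{p \<in> A. \<phi> p \<in> B} = {}"
        using image_avoids True X by blast
      then show ?thesis by (metis finite.emptyI)
    next
      case B: False
      then have "finite (A \<inter> B)"
        using ad A subsetD[OF \<F>(2) that] True unfolding almost_disjoint_family_def by metis
      moreover have "finite {p \<in> X. (p \<in> B) \<noteq> (\<phi> p \<in> B)}"
        using B that \<F>(2) by (intro mirror) auto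
      moreover have "{p \<in> A. \<phi> p \<in> B} \<subseteq> (A \<inter> B) \<union> {p \<in> X. (p \<in> B) \<noteq> (\<phi> p \<in> B)}"
        using True X by blast
      ultimately show ?thesis
        by (meson finite_UnI finite_subset)
    qed
    then have "finite (?N \<union> (\<Union>B\<in>\<F>. {p \<in> A. \<phi> p \<in> B}))"
      using N \<F>(1) by blast
    moreover have "{p \<in> A. e \<le> \<bar>mirror_fun \<A> \<S> X \<phi> f (Pt p) - mirror_fun \<A> \<S> X \<phi> f (LimPt A)\<bar>}
        \<subseteq> ?N \<union> (\<Union>B\<in>\<F>. {p \<in> A. \<phi> p \<in> B})"
    proof
      fix p assume p: "p \<in> {p \<in> A. e \<le> \<bar>mirror_fun \<A> \<S> X \<phi> f (Pt p) - mirror_fun \<A> \<S> X \<phi> f (LimPt A)\<bar>}"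
      then have "p \<in> \<Union>\<A>" "p \<in> X"
        using A True X by auto
      then have "e \<le> \<bar>(K_val f (Pt p) - K_val f (LimPt A)) - (val_or_Infty \<A> f (\<phi> p) - K_val f Infty)\<bar>"
        using p A True by (simp add: algebra_simps)
      then have "e / 2 \<le> \<bar>K_val f (Pt p) - K_val f (LimPt A)\<bar> \<or>
          e / 2 \<le> \<bar>val_or_Infty \<A> f (\<phi> p) - K_val f Infty\<bar>"
        by linarith
      then show "p \<in> ?N \<union> (\<Union>B\<in>\<F>. {p \<in> A. \<phi> p \<in> B})"
        using p \<F>(3) by auto
    qed
    ultimately show ?thesis
      using finite_subset by blast
  next
    case False
    then have D: "finite {p \<in> X. (p \<in> A) \<noteq> (\<phi> p \<in> A)}"
      using A by (intro mirror) auto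
    have "finite (\<phi> ` {p \<in> X. \<phi> p \<in> ?N})"
      using N by (rule rev_finite_subset) auto
    then have M: "finite {p \<in> X. \<phi> p \<in> ?N}"
      by (rule finite_imageD) (rule inj_on_subset[OF inj], auto)
    have "{p \<in> A. e \<le> \<bar>mirror_fun \<A> \<S> X \<phi> f (Pt p) - mirror_fun \<A> \<S> X \<phi> f (LimPt A)\<bar>}
        \<subseteq> ?N \<union> {p \<in> X. \<phi> p \<in> ?N} \<union> {p \<in> X. (p \<in> A) \<noteq> (\<phi> p \<in> A)}"
    proof
      fix p assume p: "p \<in> {p \<in> A. e \<le> \<bar>mirror_fun \<A> \<S> X \<phi> f (Pt p) - mirror_fun \<A> \<S> X \<phi> f (LimPt A)\<bar>}"
      then have pA: "p \<in> A" "p \<in> \<Union>\<A>"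
        using A by auto
      have pX: "p \<in> X"
        using p pA(2) False A \<open>e > 0\<close> by (cases "p \<in> X") simp_all
      have far: "e \<le> \<bar>K_val f (Pt p) - val_or_Infty \<A> f (\<phi> p)\<bar>"
        using p pA(2) pX False A by (simp add: algebra_simps)
      show "p \<in> ?N \<union> {p \<in> X. \<phi> p \<in> ?N} \<union> {p \<in> X. (p \<in> A) \<noteq> (\<phi> p \<in> A)}"
      proof (cases "\<phi> p \<in> A")
        case True
        then have "val_or_Infty \<A> f (\<phi> p) = K_val f (Pt (\<phi> p))"
          using A by (auto simp: val_or_Infty_def)
        then have "e / 2 \<le> \<bar>K_val f (Pt p) - K_val f (LimPt A)\<bar> \<or>
            e / 2 \<le> \<bar>K_val f (Pt (\<phi> p)) - K_val f (LimPt A)\<bar>"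
          using far by linarith
        then show ?thesis
          using pA(1) pX True by blast
      qed (use pA(1) pX in blast)
    qed
    then show ?thesis
      using N M D finite_subset by blast
  qed
next
  fix e :: real assume "e > 0"
  then have e2: "e / 2 > 0" by simp
  obtain \<F> where \<F>: "finite \<F>" "\<F> \<subseteq> \<A>"
    "\<And>x. x \<in> K_points \<A> \<Longrightarrow> e / 2 \<le> \<bar>K_val f x - K_val f Infty\<bar> \<Longrightarrow> x \<in> (\<Union>A\<in>\<F>. K_nbhd A)"
    "\<And>q. e / 2 \<le> \<bar>val_or_Infty \<A> f q - K_val f Infty\<bar> \<Longrightarrow> q \<in> \<Union>\<F>"
    by (rule far_from_Infty[OF f e2]) blast
  define D where "D = (\<Union>B\<in>\<F> - \<S>. {p \<in> X. (p \<in> B) \<noteq> (\<phi> p \<in> B)}) \<inter> \<Union>\<A>"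
  have "finite D"
    using \<F>(1,2) mirror by (auto simp: D_def)
  moreover have "\<forall>p\<in>D. \<exists>A. A \<in> \<A> \<and> p \<in> A"
    by (auto simp: D_def)
  then obtain c where c: "\<And>p. p \<in> D \<Longrightarrow> c p \<in> \<A> \<and> p \<in> c p"
    by metis
  ultimately have "finite (\<F> \<union> c ` D)" "\<F> \<union> c ` D \<subseteq> \<A>"
    using \<F>(1,2) by auto
  moreover have "{x \<in> K_points \<A>. e \<le> \<bar>mirror_fun \<A> \<S> X \<phi> f x - mirror_fun \<A> \<S> X \<phi> f Infty\<bar>}
      \<subseteq> (\<Union>A\<in>\<F> \<union> c ` D. K_nbhd A)"
  proof
    fix x assume x: "x \<in> {x \<in> K_points \<A>. e \<le> \<bar>mirror_fun \<A> \<S> X \<phi> f x - mirror_fun \<A> \<S> X \<phi> f Infty\<bar>}"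
    show "x \<in> (\<Union>A\<in>\<F> \<union> c ` D. K_nbhd A)"
    proof (cases x)
      case (Pt p)
      then have p: "p \<in> \<Union>\<A>" "p \<in> X" "e \<le> \<bar>K_val f (Pt p) - val_or_Infty \<A> f (\<phi> p)\<bar>"
        using x \<open>e > 0\<close> by (auto split: if_splits)
      then consider "e / 2 \<le> \<bar>K_val f (Pt p) - K_val f Infty\<bar>"
        | "e / 2 \<le> \<bar>val_or_Infty \<A> f (\<phi> p) - K_val f Infty\<bar>"
        by linarith
      then show ?thesis
      proof cases
        case 1
        then show ?thesis
          using \<F>(3)[of x] Pt x by auto
      next
        case 2
        then obtain B where B: "B \<in> \<F>" "\<phi> p \<in> B"
          using \<F>(4) by blast
        then have "B \<notin> \<S>"
          using image_avoids p(2) by blast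
        then have "p \<in> B \<or> p \<in> D"
          using B p by (auto simp: D_def)
        then show ?thesis
          using B(1) c[of p] Pt by auto
      qed
    next
      case (LimPt A)
      then show ?thesis
        using x \<F>(3)[of x] \<open>e > 0\<close> by (auto split: if_splits)
    next
      case Infty
      then show ?thesis
        using x \<open>e > 0\<close> by auto
    qed
  qed
  ultimately show "\<exists>\<F>. finite \<F> \<and> \<F> \<subseteq> \<A> \<and>
      {x \<in> K_points \<A>. e \<le> \<bar>mirror_fun \<A> \<S> X \<phi> f x - mirror_fun \<A> \<S> X \<phi> f Infty\<bar>} \<subseteq> (\<Union>A\<in>\<F>. K_nbhd A)"
    by (intro exI[of _ "\<F> \<union> c ` D"] conjI)
qed

lemma mirror_proj_image:
  assumes "f \<in> CK \<A>"
  shows "mirror_proj \<A> \<S> X \<phi> f \<in> CK_supported_on \<A> (Pt ` X \<union> LimPt ` \<S>)"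
proof -
  have "mirror_fun \<A> \<S> X \<phi> f x = K_val f Infty" if "x \<in> K_points \<A> - (Pt ` X \<union> LimPt ` \<S>)" for x
    using that by (cases x) auto
  then show ?thesis
    using mirror_proj_in_CK[OF assms] by (simp add: CK_supported_on_def K_val_mirror_proj)
qed

lemma mirror_proj_fixes:
  assumes f: "f \<in> CK_supported_on \<A> (Pt ` X \<union> LimPt ` \<S>)"
  shows "mirror_proj \<A> \<S> X \<phi> f = f"
proof (rule K_val_eqI)
  fix x
  have f_CK: "f \<in> CK \<A>" and f_off: "\<And>y. y \<in> K_points \<A> - (Pt ` X \<union> LimPt ` \<S>) \<Longrightarrow> K_val f y = K_val f Infty"
    using f by (auto simp: CK_supported_on_def)
  have "val_or_Infty \<A> f (\<phi> p) = K_val f Infty" if "p \<in> X" for p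
  proof -
    have "\<phi> p \<notin> X"
      using that disj by blast
    then show ?thesis
      using f_off[of "Pt (\<phi> p)"] by (auto simp: val_or_Infty_def)
  qed
  then have "mirror_fun \<A> \<S> X \<phi> f x = K_val f x"
    using f_off[of x] CK_outside[OF f_CK, of x] by (cases x) (auto simp: image_iff)
  then show "K_val (mirror_proj \<A> \<S> X \<phi> f) x = K_val f x"
    by (simp add: K_val_mirror_proj)
qed

text \<open>A function that is constant off \<open>X \<union> {l\<^sub>A : A \<in> \<S>}\<close> takes the value \<open>f(\<infinity>)\<close> at \<open>\<phi> p\<close> for \<open>p \<in> X\<close>, since
\<open>\<phi> p \<notin> X\<close>; the subtracted and the added term cancel and \<open>P f = f\<close>.\<close>

lemma complemented_CK_supported_on:
  "complemented_in (CK \<A>) (CK_supported_on \<A> (Pt ` X \<union> LimPt ` \<S>))"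
  unfolding complemented_in_def
proof (intro exI conjI)
  have sub: "CK_supported_on \<A> (Pt ` X \<union> LimPt ` \<S>) \<subseteq> CK \<A>"
    by (auto simp: CK_supported_on_def)
  show "projection_on (CK \<A>) (mirror_proj \<A> \<S> X \<phi>)"
    unfolding projection_on_def bounded_linear_on_def
  proof (intro conjI ballI allI exI[of _ 3])
    show "norm (mirror_proj \<A> \<S> X \<phi> f) \<le> 3 * norm f" for f
      by (rule norm_le_K_val) (simp add: K_val_mirror_proj abs_mirror_fun_le)
  qed (use mirror_proj_linear mirror_proj_in_CK mirror_proj_fixes mirror_proj_image in auto)
  show "mirror_proj \<A> \<S> X \<phi> ` CK \<A> = CK_supported_on \<A> (Pt ` X \<union> LimPt ` \<S>)"
  proof
    show "mirror_proj \<A> \<S> X \<phi> ` CK \<A> \<subseteq> CK_supported_on \<A> (Pt ` X \<union> LimPt ` \<S>)"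
      using mirror_proj_image by blast
    show "CK_supported_on \<A> (Pt ` X \<union> LimPt ` \<S>) \<subseteq> mirror_proj \<A> \<S> X \<phi> ` CK \<A>"
    proof
      fix f assume "f \<in> CK_supported_on \<A> (Pt ` X \<union> LimPt ` \<S>)"
      then show "f \<in> mirror_proj \<A> \<S> X \<phi> ` CK \<A>"
        using mirror_proj_fixes[of f] sub by (intro image_eqI[of _ _ f]) auto
    qed
  qed
qed

end

text \<open>A countable dense subset of \<open>F\<close> has countable supports, which countably many members of \<open>\<A>\<close> cover; the
mirror property provides \<open>\<S>\<close> and \<open>X\<close> above these members, and uniform limits do not leave the space
of functions supported there.\<close>

theorem SCP_if_mirrored:
  assumes ad: "almost_disjoint_family \<A>" and cnt: "\<And>A. A \<in> \<A> \<Longrightarrow> countable A"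
    and mirrored: "mirrored \<A>"
  shows "SCP (CK \<A>)"
  unfolding SCP_def
proof (intro allI impI, elim conjE)
  fix F assume F: "F \<subseteq> CK \<A>" "separable_space (top_of_set F)"
  then obtain C where C: "countable C" "C \<subseteq> F" "\<forall>f\<in>F. \<forall>e>0. \<exists>c\<in>C. dist c f < e"
    unfolding separable_top_of_set_iff by auto
  define N where "N = (\<Union>c\<in>C. {x \<in> K_points \<A>. K_val c x \<noteq> K_val c Infty})"
  have N: "countable N"
    unfolding N_def using C(1,2) F(1) cnt by (intro countable_UN countable_support_CK) auto
  have "\<exists>A. A \<in> \<A> \<and> x \<in> K_nbhd A" if "x \<in> N" for x
    using that by (cases x) (auto simp: N_def)
  then obtain A where A: "\<And>x. x \<in> N \<Longrightarrow> A x \<in> \<A> \<and> x \<in> K_nbhd (A x)"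
    by metis
  have "countable (A ` N) \<and> A ` N \<subseteq> \<A>"
    using N A by auto
  then obtain \<S> X \<phi> where wit: "countable \<S>" "A ` N \<subseteq> \<S>" "\<S> \<subseteq> \<A>" "countable X" "\<Union>\<S> \<subseteq> X"
    "inj_on \<phi> X" "\<phi> ` X \<inter> X = {}" "\<And>A. A \<in> \<A> - \<S> \<Longrightarrow> finite {p \<in> X. (p \<in> A) \<noteq> (\<phi> p \<in> A)}"
    using mirrored[unfolded mirrored_def, rule_format, of "A ` N"] by auto
  interpret mirror \<A> \<S> X \<phi>
    using ad wit by unfold_locales
  let ?Z = "CK_supported_on \<A> (Pt ` X \<union> LimPt ` \<S>)"
  have N_sub: "N \<subseteq> Pt ` X \<union> LimPt ` \<S>"
  proof
    fix x assume x: "x \<in> N"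
    then have "x \<in> K_nbhd (A x)" "A x \<in> \<S>"
      using A wit(2) by auto
    then show "x \<in> Pt ` X \<union> LimPt ` \<S>"
      using wit(5) by (auto simp: K_nbhd_def)
  qed
  have "F \<subseteq> ?Z"
  proof
    fix f assume f: "f \<in> F"
    have "K_val f x = K_val f Infty" if x: "x \<in> K_points \<A> - (Pt ` X \<union> LimPt ` \<S>)" for x
    proof (rule ccontr)
      define d where "d = \<bar>K_val f x - K_val f Infty\<bar>"
      assume "K_val f x \<noteq> K_val f Infty"
      then have "d / 2 > 0"
        by (simp add: d_def)
      then obtain c where c: "c \<in> C" "dist c f < d / 2"
        using C(3) f by blast
      have eq: "K_val c x = K_val c Infty"
        using x N_sub c(1) by (auto simp: N_def)
      have le: "\<bar>K_val c y - K_val f y\<bar> \<le> dist c f" for y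
        using abs_K_val_le[of "c - f" y] by (simp add: dist_norm)
      have "d \<le> dist c f + dist c f"
        unfolding d_def using le[of x] le[of Infty] eq by arith
      then show False
        using c(2) by linarith
    qed
    then show "f \<in> ?Z"
      using f F(1) by (auto simp: CK_supported_on_def)
  qed
  then show "\<exists>Z. F \<subseteq> Z \<and> separable_space (top_of_set Z) \<and> complemented_in (CK \<A>) Z"
    using separable_CK_supported_on[OF wit(1,3,4,5)] complemented_CK_supported_on by blast
qed

section \<open>A mirrored family indexed by the countable ordinals\<close>

text \<open>This is the first uncountable ordinal realised inside \<open>U\<close>: well-order \<open>U\<close> and keep the elements with
countably many predecessors. If these were countable, the least element that was dropped would have only
countably many predecessors.\<close>

lemma uncountable_set_with_countable_initial_segments:
  fixes U :: "'a set"
  assumes "uncountable U"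
  obtains W D where "W \<subseteq> U" "uncountable W"
    "\<And>a. a \<in> W \<Longrightarrow> a \<in> D a \<and> D a \<subseteq> W \<and> countable (D a)"
    "\<And>a b. b \<in> D a \<Longrightarrow> D b \<subseteq> D a"
    "\<And>a b. a \<in> W \<Longrightarrow> b \<in> W \<Longrightarrow> a \<in> D b \<or> b \<in> D a"
proof -
  obtain r where r: "well_order_on U r"
    using well_order_on by blast
  then have lin: "refl_on U r" "trans r" "total_on U r" "r \<subseteq> U \<times> U" and wf: "wf (r - Id)"
    by (auto simp: well_order_on_def linear_order_on_def partial_order_on_def preorder_on_def)
  define D where "D a = {b. (b, a) \<in> r}" for a
  define W where "W = {a \<in> U. countable (D a)}"
  have trans: "D b \<subseteq> D a" if "b \<in> D a" for a b
    using that lin(2) by (auto simp: D_def trans_def)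
  show ?thesis
  proof (rule that[of W D])
    show "uncountable W"
    proof
      assume W: "countable W"
      then have "U - W \<noteq> {}"
        using assms countable_subset[of U W] by blast
      then obtain m where m: "m \<in> U - W" and min: "\<And>y. (y, m) \<in> r - Id \<Longrightarrow> y \<notin> U - W"
        using wfE_min[OF wf] by (metis all_not_in_conv)
      have "D m \<subseteq> insert m W"
        using min lin(4) by (auto simp: D_def)
      then have "countable (D m)"
        using W by (meson countable_insert countable_subset)
      then show False
        using m by (simp add: W_def)
    qed
  next
    fix a assume a: "a \<in> W"
    have "D a \<subseteq> W"
    proof
      fix b assume b: "b \<in> D a"
      then have "countable (D b)"
        using trans a countable_subset unfolding W_def by blast
      then show "b \<in> W"
        using b lin(4) by (auto simp: W_def D_def)
    qed
    then show "a \<in> D a \<and> D a \<subseteq> W \<and> countable (D a)"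
      using a lin(1) by (auto simp: W_def D_def refl_on_def)
  next
    fix a b assume "a \<in> W" "b \<in> W"
    then show "a \<in> D b \<or> b \<in> D a"
      using lin(1,3) by (cases "a = b") (auto simp: W_def D_def total_on_def refl_on_def)
  qed (use trans in \<open>auto simp: W_def\<close>)
qed

text \<open>Iterate an injective pairing function on the reals and record the length of the list.\<close>

lemma inj_real_list_to_real: "\<exists>c :: real list \<Rightarrow> real. inj c"
proof -
  have "infinite (UNIV :: real set)"
    using uncountable_UNIV_real countable_finite by blast
  then obtain q :: "real \<times> real \<Rightarrow> real" where "bij_betw q (UNIV \<times> UNIV) UNIV"
    using card_of_Times_same_infinite[of "UNIV :: real set"] by (auto simp flip: card_of_ordIso)
  then have q: "q (x, y) = q (x', y') \<longleftrightarrow> x = x' \<and> y = y'" for x y x' y'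
    using inj_eq[of q "(x, y)" "(x', y')"] by (simp add: bij_betw_def)
  define c where "c l = q (real (length l), foldr (\<lambda>x y. q (x, y)) l 0)" for l
  have "l = l'" if "length l = length l'"
    "foldr (\<lambda>x y. q (x, y)) l 0 = foldr (\<lambda>x y. q (x, y)) l' 0" for l l'
    using that by (induction l l' rule: list_induct2) (auto simp: q)
  then have "inj c"
    by (auto simp: inj_def c_def q)
  then show ?thesis by (rule exI[of inj c])
qed

text \<open>The pair \<open>(k, \<lfloor>2\<^sup>k a\<rfloor>)\<close> names the dyadic interval of length \<open>2\<^sup>-\<^sup>k\<close> that contains \<open>a\<close>, so these pairs form the
branch of \<open>a\<close> in a binary tree. Only lists without repetitions are admitted, so that
for each \<open>k\<close> there are finitely many of them.\<close>

definition tree_family_member :: "(real \<Rightarrow> real set) \<Rightarrow> real \<Rightarrow> (nat \<times> int \<times> real list) set" where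
  "tree_family_member D a =
     {(k, \<lfloor>2 ^ k * a\<rfloor>, l) | k l. distinct l \<and> set l \<subseteq> {d \<in> D a. to_nat_on (D a) d \<le> k}}"

lemma mem_tree_family_member:
  "(k, m, l) \<in> tree_family_member D a \<longleftrightarrow>
     m = \<lfloor>2 ^ k * a\<rfloor> \<and> distinct l \<and> set l \<subseteq> {d \<in> D a. to_nat_on (D a) d \<le> k}"
  by (auto simp: tree_family_member_def)

lemma finite_tree_family_member_below:
  assumes "countable (D a)"
  shows "finite {p \<in> tree_family_member D a. fst p \<le> n}"
proof -
  let ?F = "\<lambda>k. {d \<in> D a. to_nat_on (D a) d \<le> k}"
  have F: "finite (?F k)" for k
  proof (rule finite_imageD)
    show "finite (to_nat_on (D a) ` ?F k)"
      by (rule finite_subset[of _ "{..k}"]) auto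
    show "inj_on (to_nat_on (D a)) (?F k)"
      using inj_on_to_nat_on[OF assms] by (rule inj_on_subset) auto
  qed
  have "finite {l. set l \<subseteq> ?F k \<and> distinct l}" for k
  proof (rule finite_subset)
    show "{l. set l \<subseteq> ?F k \<and> distinct l} \<subseteq> {l. set l \<subseteq> ?F k \<and> length l \<le> card (?F k)}"
      using F by (auto simp: distinct_card[symmetric] intro!: card_mono)
    show "finite {l. set l \<subseteq> ?F k \<and> length l \<le> card (?F k)}"
      using F by (rule finite_lists_length_le)
  qed
  then have "finite (\<Union>k\<le>n. (\<lambda>l. (k, \<lfloor>2 ^ k * a\<rfloor>, l)) ` {l. set l \<subseteq> ?F k \<and> distinct l})"
    by blast
  then show ?thesis
    by (rule rev_finite_subset) (auto simp: tree_family_member_def)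
qed

text \<open>Different reals share only finitely many dyadic intervals, and each interval contributes finitely many points.\<close>

lemma almost_disjoint_tree_family_member:
  assumes "countable (D a)" "a \<noteq> b"
  shows "finite (tree_family_member D a \<inter> tree_family_member D b)"
proof -
  obtain n where n: "1 / \<bar>a - b\<bar> < 2 ^ n"
    using real_arch_pow[of 2] by auto
  have "k \<le> n" if "\<lfloor>2 ^ k * a\<rfloor> = \<lfloor>2 ^ k * b\<rfloor>" for k
  proof (rule ccontr)
    assume "\<not> k \<le> n"
    then have "(2::real) ^ n \<le> 2 ^ k"
      by simp
    with n have "1 / \<bar>a - b\<bar> < 2 ^ k"
      by linarith
    then have "1 < 2 ^ k * \<bar>a - b\<bar>"
      using assms(2) by (simp add: field_simps)
    also have "\<dots> = \<bar>2 ^ k * a - 2 ^ k * b\<bar>"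
      by (simp add: abs_mult right_diff_distrib[symmetric])
    also have "\<dots> < 1"
      using that by linarith
    finally show False .
  qed
  then have "tree_family_member D a \<inter> tree_family_member D b
      \<subseteq> {p \<in> tree_family_member D a. fst p \<le> n}"
    by (auto simp: tree_family_member_def)
  then show ?thesis
    using finite_tree_family_member_below[of D a n, OF assms(1)] finite_subset by blast
qed

lemma countable_tree_family_member:
  assumes "countable (D a)"
  shows "countable (tree_family_member D a)"
proof -
  have "tree_family_member D a = (\<Union>n. {p \<in> tree_family_member D a. fst p \<le> n})"
    by auto
  also have "countable \<dots>"
    using finite_tree_family_member_below[of D a] assms by (intro countable_UN) (auto simp: countable_finite)
  finally show ?thesis .
qed

text \<open>Given countably many indices, take \<open>\<delta>\<close> not below any of them, let \<open>\<S>\<close> belong to all indices that are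
not above \<open>\<delta>\<close>, and let \<open>X\<close> be the triples whose lists have entries strictly below \<open>\<delta>\<close>. For \<open>\<delta> \<in> D a\<close>, prefixing
\<open>\<delta>\<close> to a list changes membership only if \<open>k\<close> is smaller than the number of \<open>\<delta>\<close> in \<open>D a\<close>, and then the
original triple is one of finitely many members.\<close>

lemma mirrored_tree_family:
  assumes W: "uncountable W"
    and D: "\<And>a. a \<in> W \<Longrightarrow> a \<in> D a \<and> D a \<subseteq> W \<and> countable (D a)"
    and D_trans: "\<And>a b. b \<in> D a \<Longrightarrow> D b \<subseteq> D a"
    and D_total: "\<And>a b. a \<in> W \<Longrightarrow> b \<in> W \<Longrightarrow> a \<in> D b \<or> b \<in> D a"
  shows "mirrored (tree_family_member D ` W)"
  unfolding mirrored_def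
proof (intro allI impI, elim conjE)
  fix \<R> assume R: "countable \<R>" "\<R> \<subseteq> tree_family_member D ` W"
  then obtain V where V: "countable V" "V \<subseteq> W" "\<R> = tree_family_member D ` V"
    using countable_subset_image by meson
  have "countable (\<Union>x\<in>V. D x)"
    using V D by auto
  then obtain \<delta> where \<delta>: "\<delta> \<in> W" "\<delta> \<notin> (\<Union>x\<in>V. D x)"
    using W countable_subset[of W "\<Union>x\<in>V. D x"] by blast
  define V' where "V' = {x \<in> W. \<delta> \<notin> D x}"
  define X :: "(nat \<times> int \<times> real list) set" where "X = {(k, m, l). distinct l \<and> set l \<subseteq> D \<delta> - {\<delta>}}"
  define \<phi> :: "nat \<times> int \<times> real list \<Rightarrow> _" where "\<phi> = (\<lambda>(k, m, l). (k, m, \<delta> # l))"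
  have V': "V' \<subseteq> D \<delta>"
    using D_total \<delta> by (auto simp: V'_def)
  have cX: "countable X"
  proof (rule countable_subset)
    show "X \<subseteq> UNIV \<times> UNIV \<times> lists (D \<delta>)"
      by (auto simp: X_def)
    show "countable ((UNIV::nat set) \<times> (UNIV::int set) \<times> lists (D \<delta>))"
      using D \<delta> by (intro countable_SIGMA countable_lists) auto
  qed
  have UX: "\<Union>(tree_family_member D ` V') \<subseteq> X"
  proof
    fix p assume "p \<in> \<Union>(tree_family_member D ` V')"
    then obtain x k m l where x: "x \<in> V'" and p: "p = (k, m, l)" "p \<in> tree_family_member D x"
      by (metis UN_E prod_cases3)
    have "D x \<subseteq> D \<delta> - {\<delta>}"
      using x V' D_trans by (auto simp: V'_def)
    then show "p \<in> X"
      using p by (auto simp: mem_tree_family_member X_def)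
  qed
  have fin: "finite {p \<in> X. (p \<in> tree_family_member D a) \<noteq> (\<phi> p \<in> tree_family_member D a)}"
    if a: "a \<in> W" "\<delta> \<in> D a" for a
  proof (rule finite_subset)
    show "finite {p \<in> tree_family_member D a. fst p \<le> to_nat_on (D a) \<delta>}"
      using D[OF a(1)] by (intro finite_tree_family_member_below) blast
    show "{p \<in> X. (p \<in> tree_family_member D a) \<noteq> (\<phi> p \<in> tree_family_member D a)}
       \<subseteq> {p \<in> tree_family_member D a. fst p \<le> to_nat_on (D a) \<delta>}"
      using a by (auto simp: X_def \<phi>_def mem_tree_family_member)
  qed
  show "\<exists>\<S> X \<phi>. countable \<S> \<and> \<R> \<subseteq> \<S> \<and> \<S> \<subseteq> tree_family_member D ` W \<and> countable X \<and> \<Union>\<S> \<subseteq> X \<and>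
        inj_on \<phi> X \<and> \<phi> ` X \<inter> X = {} \<and>
        (\<forall>A\<in>tree_family_member D ` W - \<S>. finite {p \<in> X. (p \<in> A) \<noteq> (\<phi> p \<in> A)})"
  proof (intro exI[of _ "tree_family_member D ` V'"] exI[of _ X] exI[of _ \<phi>] conjI)
    show "countable (tree_family_member D ` V')"
      using V' D \<delta> by (meson countable_image countable_subset)
    show "\<R> \<subseteq> tree_family_member D ` V'"
      using V \<delta> by (auto simp: V'_def)
    show "\<forall>A\<in>tree_family_member D ` W - tree_family_member D ` V'.
        finite {p \<in> X. (p \<in> A) \<noteq> (\<phi> p \<in> A)}"
      using fin by (auto simp: V'_def)
  qed (use UX cX in \<open>auto simp: V'_def X_def \<phi>_def inj_on_def\<close>)
qed

lemma mirrored_image: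
  assumes h: "inj h" and \<A>: "mirrored \<A>"
  shows "mirrored ((`) h ` \<A>)"
  unfolding mirrored_def
proof (intro allI impI, elim conjE)
  fix \<R> assume R: "countable \<R>" "\<R> \<subseteq> (`) h ` \<A>"
  then obtain \<R>' where R': "countable \<R>'" "\<R>' \<subseteq> \<A>" "\<R> = (`) h ` \<R>'"
    using countable_subset_image by meson
  then obtain \<S> X \<phi> where S: "countable \<S>" "\<R>' \<subseteq> \<S>" "\<S> \<subseteq> \<A>" "countable X" "\<Union>\<S> \<subseteq> X"
    "inj_on \<phi> X" "\<phi> ` X \<inter> X = {}" "\<And>A. A \<in> \<A> - \<S> \<Longrightarrow> finite {p \<in> X. (p \<in> A) \<noteq> (\<phi> p \<in> A)}"
    using \<A>[unfolded mirrored_def, rule_format, of \<R>'] by auto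
  define \<psi> where "\<psi> = h \<circ> \<phi> \<circ> inv h"
  have \<psi>: "\<psi> (h x) = h (\<phi> x)" for x
    using h by (simp add: \<psi>_def)
  have fin: "finite {p \<in> h ` X. (p \<in> h ` A) \<noteq> (\<psi> p \<in> h ` A)}" if "A \<in> \<A> - \<S>" for A
  proof -
    have "{p \<in> h ` X. Q p} = h ` {p \<in> X. Q (h p)}" for Q
      by auto
    then have "{p \<in> h ` X. (p \<in> h ` A) \<noteq> (\<psi> p \<in> h ` A)} =
        h ` {p \<in> X. (h p \<in> h ` A) \<noteq> (\<psi> (h p) \<in> h ` A)}" .
    also have "\<dots> = h ` {p \<in> X. (p \<in> A) \<noteq> (\<phi> p \<in> A)}"
      by (simp only: \<psi> inj_image_mem_iff[OF h])
    finally have "{p \<in> h ` X. (p \<in> h ` A) \<noteq> (\<psi> p \<in> h ` A)} =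
        h ` {p \<in> X. (p \<in> A) \<noteq> (\<phi> p \<in> A)}" .
    then show ?thesis
      using S(8)[OF that] by simp
  qed
  show "\<exists>\<S> X \<phi>. countable \<S> \<and> \<R> \<subseteq> \<S> \<and> \<S> \<subseteq> (`) h ` \<A> \<and> countable X \<and> \<Union>\<S> \<subseteq> X \<and>
        inj_on \<phi> X \<and> \<phi> ` X \<inter> X = {} \<and>
        (\<forall>A\<in>(`) h ` \<A> - \<S>. finite {p \<in> X. (p \<in> A) \<noteq> (\<phi> p \<in> A)})"
  proof (intro exI[of _ "(`) h ` \<S>"] exI[of _ "h ` X"] exI[of _ \<psi>] conjI)
    show "inj_on \<psi> (h ` X)"
      using S(6) h by (auto simp: inj_on_def \<psi>)
    show "\<psi> ` h ` X \<inter> h ` X = {}"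
      using S(7) h by (auto simp: \<psi> inj_eq)
    show "\<forall>A\<in>(`) h ` \<A> - (`) h ` \<S>. finite {p \<in> h ` X. (p \<in> A) \<noteq> (\<psi> p \<in> A)}"
      using fin by auto
    show "\<Union>((`) h ` \<S>) \<subseteq> h ` X"
      using S(5) by auto
  qed (use S(1-4) R'(3) in \<open>simp_all add: image_mono\<close>)
qed

theorem exists_mirrored_family:
  obtains \<A> :: "real set set" and L where "almost_disjoint_family \<A>" "\<And>A. A \<in> \<A> \<Longrightarrow> countable A"
    "uncountable \<A>" "mirrored \<A>" "levelled \<A> L"
proof -
  have "uncountable {0..<1::real}"
    using uncountable_half_open_interval_1 by simp
  then obtain W D where W: "W \<subseteq> {0..<1::real}" "uncountable W"
    and D: "\<And>a. a \<in> W \<Longrightarrow> a \<in> D a \<and> D a \<subseteq> W \<and> countable (D a)"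
    "\<And>a b. b \<in> D a \<Longrightarrow> D b \<subseteq> D a"
    "\<And>a b. a \<in> W \<Longrightarrow> b \<in> W \<Longrightarrow> a \<in> D b \<or> b \<in> D a"
    by (rule uncountable_set_with_countable_initial_segments) (rule that)
  obtain c :: "real list \<Rightarrow> real" where c: "inj c"
    using inj_real_list_to_real by blast
  define h :: "nat \<times> int \<times> real list \<Rightarrow> real" where "h = (\<lambda>(k, m, l). c (real k # real_of_int m # l))"
  have h: "inj h"
    using c by (auto simp: inj_def h_def dest: injD[OF c])
  define T where "T = tree_family_member D"
  have lev: "(k, \<lfloor>2 ^ k * a\<rfloor>, []) \<in> T a" for k a
    by (simp add: T_def mem_tree_family_member)
  have inf: "infinite (T a)" for a
  proof
    assume "finite (T a)"
    moreover have "UNIV \<subseteq> fst ` T a"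
      using lev by (metis fst_conv image_iff subsetI)
    ultimately show False
      using finite_subset infinite_UNIV_nat by blast
  qed
  have ad: "finite (T a \<inter> T b)" if "a \<in> W" "a \<noteq> b" for a b
    using that D(1) almost_disjoint_tree_family_member unfolding T_def by blast
  have inj: "inj_on T W"
    using ad inf by (intro inj_onI) (metis Int_absorb)
  define \<A> where "\<A> = (`) h ` T ` W"
  define L where "L n = h ` ({n} \<times> {0..<2 ^ n} \<times> {[]})" for n :: nat
  show ?thesis
  proof (rule that[of \<A> L])
    show "almost_disjoint_family \<A>"
      unfolding almost_disjoint_family_def
    proof (intro conjI ballI impI)
      fix A B assume "A \<in> \<A>" "B \<in> \<A>" "A \<noteq> B"
      then obtain a b where "A = h ` T a" "B = h ` T b" "a \<in> W" "a \<noteq> b"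
        by (auto simp: \<A>_def)
      then show "finite (A \<inter> B)"
        using ad[of a b] by (simp flip: image_Int[OF h])
    qed (use inf finite_imageD[OF _ inj_on_subset[OF h]] in \<open>auto simp: \<A>_def\<close>)
    show "countable A" if "A \<in> \<A>" for A
    proof -
      obtain a where "a \<in> W" "A = h ` T a"
        using \<open>A \<in> \<A>\<close> by (auto simp: \<A>_def)
      then show ?thesis
        using D(1) countable_tree_family_member[of D a] by (simp add: T_def)
    qed
    show "uncountable \<A>"
    proof
      assume "countable \<A>"
      then have "countable (T ` W)"
        unfolding \<A>_def by (rule countable_image_inj_on) (simp add: inj_on_def inj_image_eq_iff[OF h])
      then show False
        using W(2) inj countable_image_inj_on by blast
    qed
    show "mirrored \<A>"
      unfolding \<A>_def T_def using h W(2) D by (intro mirrored_image mirrored_tree_family)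
    show "levelled \<A> L"
      unfolding levelled_def
    proof (intro conjI allI impI ballI)
      show "finite (L n)" for n
        by (simp add: L_def)
      show "L m \<inter> L n = {}" if "m \<noteq> n" for m n
        using that h by (auto simp: L_def inj_eq)
      fix A n assume "A \<in> \<A>"
      then obtain a where a: "a \<in> W" "A = h ` T a"
        by (auto simp: \<A>_def)
      then have a01: "0 \<le> a" "a < 1"
        using W(1) by auto
      have "\<lfloor>2 ^ n * a\<rfloor> < 2 ^ n"
        using a01 by (simp add: floor_less_iff)
      then have "h (n, \<lfloor>2 ^ n * a\<rfloor>, []) \<in> A \<inter> L n"
        using lev a a01 by (auto simp: L_def)
      then show "A \<inter> L n \<noteq> {}" by blast
    qed
  qed
qed

theorem theorem1p8:
  shows "\<exists>\<A> :: real set set.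
    almost_disjoint_family \<A> \<and> (\<forall>A\<in>\<A>. countable A) \<and>
    \<not> locally_small \<A> \<and>
    \<not> monolithic (K_space \<A>) \<and>
    \<not> controlled_SCP (C_space (K_space \<A>)) \<and>
    \<not> Lindelof_space (weak_topology (C_space (K_space \<A>))) \<and>
    \<not> monolithic (subtopology (weak_star_topology (C_space (K_space \<A>)))
                               (dual_unit_ball (C_space (K_space \<A>)))) \<and>
    SCP (C_space (K_space \<A>))"
proof -
  obtain \<A> :: "real set set" and L where \<A>: "almost_disjoint_family \<A>"
    "\<And>A. A \<in> \<A> \<Longrightarrow> countable A" "uncountable \<A>" "mirrored \<A>" "levelled \<A> L"
    by (rule exists_mirrored_family) (rule that)
  have "\<not> locally_small \<A>"
    by (rule not_locally_small_if_levelled[OF \<A>(5,3)])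
  then show ?thesis
    using \<A>(1,2) not_monolithic_K_space not_controlled_SCP[OF \<A>(1)]
      not_weakly_Lindelof[OF \<A>(1,3,5)] not_monolithic_dual_unit_ball[OF \<A>(1)]
      SCP_if_mirrored[OF \<A>(1,2,4)]
    by (intro exI[of _ \<A>]) simp
qed

end
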